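(* If the subgroups $A_1,\ldots,A_r$ are benign in a finitely generated group $G$, then: (1) their intersection $I=\bigcap_{i=1}^r A_i$ also is benign in $G$; (2) their join $J=\big\langle\bigcup_{i=1}^r A_i\big\rangle$ also is benign in $G$. Moreover, if the finitely presented groups $K_i$ with their finitely generated subgroups $L_i$ can be given for each $A_i$ explicitly, then the respective finitely presented overgroups $K_I$ and $K_J$ with finitely generated subgroups $L_I$ and $L_J$ can also be given for $I$ and for $J$ explicitly.
   Context: A subgroup $H$ of a finitely generated group $G$ is called benign in $G$ if $G$ can be embedded in a finitely presented group $K$ with a finitely generated subgroup $L\le K$ such that $G\cap L=H$. For a benign subgroup $H$ one writes $K=K_H$ and $L=L_H$ for such a pair of groups. Thus $K_i, L_i$ denote groups as in this definition for $H=A_i$ (so $G\le K_i$ and $G\cap L_i=A_i$), $K_I, L_I$ denote such groups for $H=I$ (so $G\le K_I$ and $G\cap L_I=I$), and $K_J, L_J$ denote such groups for $H=J$ (so $G\le K_J$ and $G\cap L_J=J$). The word "explicitly" is used in its ordinary informal sense, with no formal definition attached. *)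

theory Defs
  imports "HOL-Algebra.Generated_Groups" "HOL-Library.Nat_Bijection"
begin

section \<open>Free groups and finite presentations\<close>

text \<open>The letter \<open>(x, True)\<close> stands for the generator \<open>x\<close>, and \<open>(x, False)\<close> for its
  formal inverse.\<close>

type_synonym 'x word = "('x \<times> bool) list"

definition words :: "'x set \<Rightarrow> 'x word set" where
  "words X = lists (X \<times> UNIV)"

inductive_set free_equiv :: "'x set \<Rightarrow> ('x word \<times> 'x word) set" for X :: "'x set" where
  refl: "w \<in> words X \<Longrightarrow> (w, w) \<in> free_equiv X"
| sym: "(u, v) \<in> free_equiv X \<Longrightarrow> (v, u) \<in> free_equiv X"
| trans: "(u, v) \<in> free_equiv X \<Longrightarrow> (v, w) \<in> free_equiv X \<Longrightarrow> (u, w) \<in> free_equiv X"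
| cancel: "u \<in> words X \<Longrightarrow> v \<in> words X \<Longrightarrow> x \<in> X \<Longrightarrow>
    (u @ [(x, b), (x, \<not> b)] @ v, u @ v) \<in> free_equiv X"

definition free_class :: "'x set \<Rightarrow> 'x word \<Rightarrow> 'x word set" where
  "free_class X w = free_equiv X `` {w}"

definition free_group :: "'x set \<Rightarrow> 'x word set monoid" where
  "free_group X =
    \<lparr>carrier = words X // free_equiv X,
     mult = (\<lambda>A B. \<Union>a\<in>A. \<Union>b\<in>B. free_class X (a @ b)),
     one = free_class X []\<rparr>"

definition normal_closure :: "('a, 'b) monoid_scheme \<Rightarrow> 'a set \<Rightarrow> 'a set" where
  "normal_closure G S = \<Inter>{N. N \<lhd> G \<and> S \<subseteq> N}"

abbreviation relator_closure :: "'x set \<Rightarrow> 'x word set \<Rightarrow> 'x word set set" where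
  "relator_closure X R \<equiv> normal_closure (free_group X) (free_class X ` R)"

definition presented_group :: "'x set \<Rightarrow> 'x word set \<Rightarrow> 'x word set set monoid" where
  "presented_group X R = free_group X Mod relator_closure X R"

definition word_elem :: "'x set \<Rightarrow> 'x word set \<Rightarrow> 'x word \<Rightarrow> 'x word set set" where
  "word_elem X R w = relator_closure X R #>\<^bsub>free_group X\<^esub> free_class X w"

definition finitely_generated :: "('a, 'b) monoid_scheme \<Rightarrow> bool" where
  "finitely_generated G \<longleftrightarrow> (\<exists>S. finite S \<and> S \<subseteq> carrier G \<and> generate G S = carrier G)"

definition finitely_presented :: "('a, 'b) monoid_scheme \<Rightarrow> bool" where
  "finitely_presented G \<longleftrightarrow> group G \<and>
    (\<exists>(n::nat) R. finite R \<and> R \<subseteq> words {..<n} \<and> G \<cong> presented_group {..<n} R)"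

section \<open>Benign subgroups\<close>

text \<open>The embedding of \<open>G\<close> in \<open>K\<close> is a monomorphism \<open>\<phi>\<close>, so that
  the condition \<open>G \<inter> L = H\<close> is read inside \<open>K\<close> after identifying \<open>G\<close> with its image.\<close>

definition benign_via ::
  "('a, 'b) monoid_scheme \<Rightarrow> 'a set \<Rightarrow> ('k, 'c) monoid_scheme \<Rightarrow> ('a \<Rightarrow> 'k) \<Rightarrow> 'k set \<Rightarrow> bool" where
  "benign_via G H K \<phi> L \<longleftrightarrow>
    group K \<and> finitely_presented K \<and> \<phi> \<in> mon G K \<and>
    subgroup L K \<and> finitely_generated (K\<lparr>carrier := L\<rparr>) \<and>
    \<phi> ` carrier G \<inter> L = \<phi> ` H"

text \<open>HOL cannot quantify over types, so the overgroup ranges over groups whose carrier lies in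
  one fixed type, that of the presented groups on generators \<open>{..<n}\<close>. Every finitely presented
  group has an isomorphic copy there; lemma \<open>benignI\<close> below shows that the choice does not matter.\<close>

type_synonym fp_elem = "nat word set set"

definition benign :: "('a, 'b) monoid_scheme \<Rightarrow> 'a set \<Rightarrow> bool" where
  "benign G H \<longleftrightarrow> subgroup H G \<and> (\<exists>(K :: fp_elem monoid) \<phi> L. benign_via G H K \<phi> L)"

section \<open>Explicitly given overgroups\<close>

text \<open>Finite data describing an overgroup \<open>K\<close> of a group with a fixed finite generating
  sequence \<open>gs\<close>, together with a subgroup \<open>L\<close>: the number of generators and the defining relators
  of \<open>K\<close>, a word for the image of each member of \<open>gs\<close>, and words generating \<open>L\<close>.\<close>

datatype overgroup_data = Overgroup_Data
  (data_gens: nat)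
  (data_rels: "nat word list")
  (data_emb: "nat word list")
  (data_sub: "nat word list")

definition data_group :: "overgroup_data \<Rightarrow> fp_elem monoid" where
  "data_group d = presented_group {..<data_gens d} (set (data_rels d))"

definition data_elem :: "overgroup_data \<Rightarrow> nat word \<Rightarrow> fp_elem" where
  "data_elem d = word_elem {..<data_gens d} (set (data_rels d))"

definition data_subgroup :: "overgroup_data \<Rightarrow> fp_elem set" where
  "data_subgroup d = generate (data_group d) (data_elem d ` set (data_sub d))"

definition explicitly_benign ::
  "('a, 'b) monoid_scheme \<Rightarrow> 'a list \<Rightarrow> 'a set \<Rightarrow> overgroup_data \<Rightarrow> bool" where
  "explicitly_benign G gs H d \<longleftrightarrow>
    subgroup H G \<and>
    set (data_rels d) \<union> set (data_emb d) \<union> set (data_sub d) \<subseteq> words {..<data_gens d} \<and>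
    length (data_emb d) = length gs \<and>
    (\<exists>\<phi>. benign_via G H (data_group d) \<phi> (data_subgroup d) \<and>
         (\<forall>j<length gs. \<phi> (gs ! j) = data_elem d (data_emb d ! j)))"

text \<open>The total recursive functions of one variable, in the equivalent formulation that
  handles several arguments through Cantor's pairing function. The last rule is minimisation of
  a regular function, which keeps all functions total.\<close>

inductive recursive_fun :: "(nat \<Rightarrow> nat) \<Rightarrow> bool" where
  zero: "recursive_fun (\<lambda>_. 0)"
| succ: "recursive_fun Suc"
| left: "recursive_fun (\<lambda>n. fst (prod_decode n))"
| right: "recursive_fun (\<lambda>n. snd (prod_decode n))"
| pair: "recursive_fun f \<Longrightarrow> recursive_fun g \<Longrightarrow> recursive_fun (\<lambda>n. prod_encode (f n, g n))"
| comp: "recursive_fun f \<Longrightarrow> recursive_fun g \<Longrightarrow> recursive_fun (\<lambda>n. f (g n))"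
| prec: "recursive_fun f \<Longrightarrow> recursive_fun g \<Longrightarrow>
    recursive_fun (\<lambda>n. case prod_decode n of (a, k) \<Rightarrow>
      rec_nat (f a) (\<lambda>i y. g (prod_encode (a, prod_encode (i, y)))) k)"
| minim: "recursive_fun f \<Longrightarrow> (\<And>n. \<exists>i. f (prod_encode (n, i)) = 0) \<Longrightarrow>
    recursive_fun (\<lambda>n. LEAST i. f (prod_encode (n, i)) = 0)"

definition word_code :: "nat word \<Rightarrow> nat" where
  "word_code w = list_encode (map (\<lambda>(x, b). prod_encode (x, of_bool b)) w)"

definition word_list_code :: "nat word list \<Rightarrow> nat" where
  "word_list_code ws = list_encode (map word_code ws)"

definition data_code :: "overgroup_data \<Rightarrow> nat" where
  "data_code d =
    prod_encode (data_gens d,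
      prod_encode (word_list_code (data_rels d),
        prod_encode (word_list_code (data_emb d), word_list_code (data_sub d))))"

definition computable :: "(overgroup_data list \<Rightarrow> overgroup_data) \<Rightarrow> bool" where
  "computable F \<longleftrightarrow>
    (\<exists>f. recursive_fun f \<and> (\<forall>ds. f (list_encode (map data_code ds)) = data_code (F ds)))"

section \<open>Basic facts\<close>

lemma words_simps [simp]: "[] \<in> words X" "u @ v \<in> words X \<longleftrightarrow> u \<in> words X \<and> v \<in> words X"
  by (auto simp: words_def)

lemma free_equiv_words:
  "(u, v) \<in> free_equiv X \<Longrightarrow> u \<in> words X \<and> v \<in> words X"
  by (induction rule: free_equiv.induct) (auto simp: words_def)

lemma equiv_free_equiv: "equiv (words X) (free_equiv X)"
proof (rule equivI)
  show "free_equiv X \<subseteq> words X \<times> words X" by (auto dest: free_equiv_words)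
  show "refl_on (words X) (free_equiv X)" by (simp add: refl_on_def free_equiv.refl)
  show "Relation.sym (free_equiv X)" by (rule symI) (rule free_equiv.sym)
  show "Relation.trans (free_equiv X)" by (rule transI) (rule free_equiv.trans)
qed

lemma free_equiv_append_left:
  "(u, v) \<in> free_equiv X \<Longrightarrow> w \<in> words X \<Longrightarrow> (w @ u, w @ v) \<in> free_equiv X"
proof (induction rule: free_equiv.induct)
  case (cancel u v x b)
  then have "w @ u \<in> words X" by simp
  from free_equiv.cancel[OF this \<open>v \<in> words X\<close> \<open>x \<in> X\<close>, of b] show ?case by simp
next
  case (trans u v u')
  then show ?case by (meson free_equiv.trans)
next
  case (sym u v)
  then show ?case by (meson free_equiv.sym)
qed (auto intro: free_equiv.refl)

lemma free_equiv_append_right: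
  "(u, v) \<in> free_equiv X \<Longrightarrow> w \<in> words X \<Longrightarrow> (u @ w, v @ w) \<in> free_equiv X"
proof (induction rule: free_equiv.induct)
  case (cancel u v x b)
  then have "v @ w \<in> words X" by simp
  from free_equiv.cancel[OF \<open>u \<in> words X\<close> this \<open>x \<in> X\<close>, of b] show ?case by simp
next
  case (trans u v u')
  then show ?case by (meson free_equiv.trans)
next
  case (sym u v)
  then show ?case by (meson free_equiv.sym)
qed (auto intro: free_equiv.refl)

lemma free_equiv_append:
  assumes "(a, a') \<in> free_equiv X" "(b, b') \<in> free_equiv X"
  shows "(a @ b, a' @ b') \<in> free_equiv X"
proof (rule free_equiv.trans)
  show "(a @ b, a' @ b) \<in> free_equiv X"
    using assms by (intro free_equiv_append_right) (auto dest: free_equiv_words)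
  show "(a' @ b, a' @ b') \<in> free_equiv X"
    using assms by (intro free_equiv_append_left) (auto dest: free_equiv_words)
qed

lemma free_class_eq_iff:
  "u \<in> words X \<Longrightarrow> v \<in> words X \<Longrightarrow> free_class X u = free_class X v \<longleftrightarrow> (u, v) \<in> free_equiv X"
  unfolding free_class_def by (rule eq_equiv_class_iff[OF equiv_free_equiv])

lemma carrier_free_group: "carrier (free_group X) = free_class X ` words X"
  by (auto simp: free_group_def quotient_def free_class_def)

lemma one_free_group: "\<one>\<^bsub>free_group X\<^esub> = free_class X []"
  by (simp add: free_group_def)

lemma mult_free_class:
  assumes "u \<in> words X" "v \<in> words X"
  shows "free_class X u \<otimes>\<^bsub>free_group X\<^esub> free_class X v = free_class X (u @ v)"
proof -
  have "free_class X (a @ b) = free_class X (u @ v)"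
    if "a \<in> free_class X u" "b \<in> free_class X v" for a b
  proof -
    have *: "(u @ v, a @ b) \<in> free_equiv X"
      using that by (simp add: free_class_def free_equiv_append)
    show ?thesis
      using free_equiv_words[OF *] free_class_eq_iff * by metis
  qed
  moreover have "u \<in> free_class X u" "v \<in> free_class X v"
    using assms by (auto simp: free_class_def intro: free_equiv.refl)
  ultimately have "(\<Union>a\<in>free_class X u. \<Union>b\<in>free_class X v. free_class X (a @ b)) =
      free_class X (u @ v)"
    by blast
  then show ?thesis
    by (simp add: free_group_def)
qed

lemma words_inverse:
  assumes "w \<in> words X"
  shows "\<exists>v\<in>words X. (v @ w, []) \<in> free_equiv X"
  using assms
proof (induction w)
  case Nil
  then show ?case by (auto intro!: bexI[of _ "[]"] free_equiv.refl)
next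
  case (Cons a w)
  obtain x b where a: "a = (x, b)" by force
  have x: "x \<in> X" and w: "w \<in> words X" using Cons.prems a by (auto simp: words_def)
  obtain v where v: "v \<in> words X" "(v @ w, []) \<in> free_equiv X" using Cons.IH[OF w] by blast
  have "(v @ [(x, \<not> b), (x, \<not> \<not> b)] @ w, v @ w) \<in> free_equiv X"
    by (rule free_equiv.cancel[OF v(1) w x])
  then have "((v @ [(x, \<not> b)]) @ a # w, []) \<in> free_equiv X"
    using free_equiv.trans[OF _ v(2)] by (simp add: a)
  moreover have "v @ [(x, \<not> b)] \<in> words X" using v x by (auto simp: words_def)
  ultimately show ?case by blast
qed

lemma group_free_group: "group (free_group X)"
proof (rule groupI)
  fix A assume "A \<in> carrier (free_group X)"
  then obtain w where w: "w \<in> words X" "A = free_class X w" by (auto simp: carrier_free_group)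
  obtain v where v: "v \<in> words X" "(v @ w, []) \<in> free_equiv X" using words_inverse[OF w(1)] by blast
  have "free_class X (v @ w) = free_class X []"
    using v free_equiv_words free_class_eq_iff by blast
  then show "\<exists>B\<in>carrier (free_group X). B \<otimes>\<^bsub>free_group X\<^esub> A = \<one>\<^bsub>free_group X\<^esub>"
    using v w by (auto simp: carrier_free_group one_free_group mult_free_class)
next
  fix A B assume "A \<in> carrier (free_group X)" "B \<in> carrier (free_group X)"
  then show "A \<otimes>\<^bsub>free_group X\<^esub> B \<in> carrier (free_group X)"
    by (auto simp: carrier_free_group mult_free_class intro!: imageI)
next
  fix A B C
  assume "A \<in> carrier (free_group X)" "B \<in> carrier (free_group X)" "C \<in> carrier (free_group X)"
  then obtain u v w where "u \<in> words X" "v \<in> words X" "w \<in> words X"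
    "A = free_class X u" "B = free_class X v" "C = free_class X w"
    by (auto simp: carrier_free_group)
  then show "A \<otimes>\<^bsub>free_group X\<^esub> B \<otimes>\<^bsub>free_group X\<^esub> C =
      A \<otimes>\<^bsub>free_group X\<^esub> (B \<otimes>\<^bsub>free_group X\<^esub> C)"
    by (simp add: mult_free_class)
next
  show "\<one>\<^bsub>free_group X\<^esub> \<in> carrier (free_group X)"
    by (simp add: carrier_free_group one_free_group)
next
  fix A assume "A \<in> carrier (free_group X)"
  then show "\<one>\<^bsub>free_group X\<^esub> \<otimes>\<^bsub>free_group X\<^esub> A = A"
    by (auto simp: carrier_free_group one_free_group mult_free_class)
qed

lemma normal_normal_closure:
  assumes "group G" "S \<subseteq> carrier G"
  shows "normal_closure G S \<lhd> G"
proof -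
  interpret group G by fact
  have "carrier G \<lhd> G"
    by (simp add: normal_inv_iff subgroup_self)
  then have ne: "{N. N \<lhd> G \<and> S \<subseteq> N} \<noteq> {}" using assms by blast
  have "subgroup (normal_closure G S) G"
    unfolding normal_closure_def
    by (rule subgroups_Inter) (use ne in \<open>auto dest: normal_imp_subgroup\<close>)
  moreover have "x \<otimes>\<^bsub>G\<^esub> h \<otimes>\<^bsub>G\<^esub> inv\<^bsub>G\<^esub> x \<in> normal_closure G S"
    if "x \<in> carrier G" "h \<in> normal_closure G S" for x h
    using that unfolding normal_closure_def by (auto intro: normal.inv_op_closed2)
  ultimately show ?thesis
    unfolding normal_inv_iff by blast
qed

lemma group_presented_group:
  assumes "R \<subseteq> words X"
  shows "group (presented_group X R)"
  unfolding presented_group_def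
  by (rule normal.factorgroup_is_group, rule normal_normal_closure[OF group_free_group])
     (use assms in \<open>auto simp: carrier_free_group\<close>)

lemma finitely_generated_subgroup_iff:
  assumes "group K" "subgroup L K"
  shows "finitely_generated (K\<lparr>carrier := L\<rparr>) \<longleftrightarrow> (\<exists>S. finite S \<and> S \<subseteq> L \<and> generate K S = L)"
  using group.generate_consistent[OF assms(1) _ assms(2)]
  by (auto simp: finitely_generated_def)

lemma benign_via_iso:
  assumes K: "benign_via G H K \<phi> L" and h: "h \<in> iso K K'" and "group K'"
  shows "benign_via G H K' (h \<circ> \<phi>) (h ` L)"
proof -
  have K: "group K" "finitely_presented K" "\<phi> \<in> mon G K" "subgroup L K"
    "finitely_generated (K\<lparr>carrier := L\<rparr>)" "\<phi> ` carrier G \<inter> L = \<phi> ` H"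
    using K by (auto simp: benign_via_def)
  interpret group_hom K K' h
    using h K(1) \<open>group K'\<close> by (auto simp: iso_def group_hom_def group_hom_axioms_def)
  have inj: "inj_on h (carrier K)" using h by (auto simp: iso_def bij_betw_def)
  have L: "L \<subseteq> carrier K" using K(4) by (rule subgroup.subset)
  have \<phi>: "\<phi> ` carrier G \<subseteq> carrier K" using K(3) by (auto simp: mon_def hom_def)
  have "K' \<cong> K" using h K(1) group.iso_sym is_isoI by blast
  then have fp: "finitely_presented K'"
    using K(2) \<open>group K'\<close> iso_trans unfolding finitely_presented_def by blast
  have mon: "h \<circ> \<phi> \<in> mon G K'"
    by (rule mon_compose[OF K(3)]) (use h in \<open>auto simp: mon_def iso_def bij_betw_def\<close>)
  have sub: "subgroup (h ` L) K'"
    using subgroup_img_is_subgroup[OF K(4)] .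
  obtain S where S: "finite S" "S \<subseteq> L" "generate K S = L"
    using K(1,4,5) finitely_generated_subgroup_iff by blast
  have "generate K' (h ` S) = h ` L"
    using generate_img[of S] S L by auto
  then have fg: "finitely_generated (K'\<lparr>carrier := h ` L\<rparr>)"
    using S finitely_generated_subgroup_iff[OF \<open>group K'\<close> sub] by blast
  have "(h \<circ> \<phi>) ` carrier G \<inter> h ` L = h ` (\<phi> ` carrier G \<inter> L)"
    unfolding image_comp[symmetric] by (rule inj_on_image_Int[OF inj \<phi> L, symmetric])
  then show ?thesis
    using \<open>group K'\<close> fp mon sub fg K(6) by (simp add: benign_via_def image_comp)
qed

lemma benignI:
  assumes "subgroup H G" and K: "benign_via G H K \<phi> L"
  shows "benign G H"
proof -
  from K have "finitely_presented K" by (simp add: benign_via_def)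
  then obtain n :: nat and R h where R: "R \<subseteq> words {..<n}" "h \<in> iso K (presented_group {..<n} R)"
    unfolding finitely_presented_def is_iso_def by blast
  show ?thesis
    using benign_via_iso[OF K R(2) group_presented_group[OF R(1)]] assms(1)
    unfolding benign_def by blast
qed

lemma explicitly_benign_imp_benign: "explicitly_benign G gs H d \<Longrightarrow> benign G H"
  unfolding explicitly_benign_def by (blast intro: benignI)

end

theory Submission
  imports Defs "HOL-Algebra.Bij"
begin

text \<open>
  \<open>K\<^sub>1, L\<^sub>1\<close> and \<open>K\<^sub>2, L\<^sub>2\<close> being overgroups for \<open>A\<^sub>1\<close> and \<open>A\<^sub>2\<close>, amalgamate \<open>K\<^sub>1\<close> and \<open>K\<^sub>2\<close>
  along \<open>G\<close> and adjoin two stable letters, \<open>t\<^sub>1\<close> commuting with \<open>L\<^sub>1\<close> and \<open>t\<^sub>2\<close> commuting with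
  \<open>L\<^sub>2\<close>. As \<open>G\<close>, \<open>L\<^sub>1\<close>, \<open>L\<^sub>2\<close> are finitely generated, finitely many relators suffice, and the
  resulting group \<open>M\<close> is finitely presented. In \<open>M\<close>, the conjugate of \<open>G\<close> by \<open>t\<^sub>1 t\<^sub>2\<close> meets \<open>G\<close> in
  \<open>A\<^sub>1 \<inter> A\<^sub>2\<close>, and the subgroup generated by the conjugates of \<open>G\<close> by \<open>t\<^sub>1\<close> and by \<open>t\<^sub>2\<close> meets
  \<open>G\<close> in the join of \<open>A\<^sub>1\<close> and \<open>A\<^sub>2\<close>; both subgroups are again finitely generated. More than two
  subgroups are handled by repeating this step along the list.

  That the intersections contain \<open>A\<^sub>1 \<inter> A\<^sub>2\<close> and the join is a computation with the commutation
  relations. The opposite inclusions, and the injectivity of \<open>G \<rightarrow> M\<close>, are usually read off normal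
  forms in amalgams and HNN extensions. Here a permutation representation of \<open>M\<close> takes their place
  (\<open>stable_action\<close>). Both \<open>K\<^sub>1\<close> and \<open>K\<^sub>2\<close> act on the pairs in \<open>K\<^sub>1 \<times> K\<^sub>2\<close> with the same
  \<open>G\<close>-component relative to chosen transversals, and the two actions agree on \<open>G\<close>. Attach two bits to
  each point and let \<open>t\<^sub>i\<close> flip the \<open>i\<close>-th bit at those points whose \<open>i\<close>-th coordinate lies in
  \<open>L\<^sub>i (G - B\<^sub>i)\<close>, for a subgroup \<open>B\<^sub>i\<close> of \<open>G\<close> that contains \<open>A\<^sub>i\<close>. That set is invariant under left
  multiplication by \<open>L\<^sub>i\<close>, so \<open>t\<^sub>i\<close> commutes with \<open>L\<^sub>i\<close>; and on the orbit of the base point under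
  \<open>G\<close>, the letter \<open>t\<^sub>i\<close> tests membership in \<open>B\<^sub>i\<close>. The choice \<open>B\<^sub>i = A\<^sub>i\<close> settles
  intersections (\<open>emb_Int_conjugate\<close>), and the choice of the join for both \<open>B\<^sub>i\<close> settles
  joins (\<open>emb_Int_generate_conjugates\<close>).

  For the effective part, the new presentation arises from the given ones by renumbering generators,
  inverting, concatenating and pairing words, that is by list operations; a calculus of functions
  that are recursive with respect to codings of their arguments and values
  (\<open>recursive_via\<close>) shows that they, and their iteration along a list, are
  recursive. The existence statement about benign subgroups follows from the effective one, because
  every benign subgroup is described by some finite data (\<open>benign_imp_explicitly_benign\<close>).
\<close>

section \<open>Recursive functions between encoded types\<close>

text \<open>The codings are parameters, so that closure properties can be stated for pairs, lists
  and words without decoding natural numbers.\<close>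

definition recursive_via :: "('a \<Rightarrow> nat) \<Rightarrow> ('b \<Rightarrow> nat) \<Rightarrow> ('a \<Rightarrow> 'b) \<Rightarrow> bool" where
  "recursive_via e e' F \<longleftrightarrow> (\<exists>f. recursive_fun f \<and> (\<forall>x. f (e x) = e' (F x)))"

definition pair_code :: "('a \<Rightarrow> nat) \<Rightarrow> ('b \<Rightarrow> nat) \<Rightarrow> 'a \<times> 'b \<Rightarrow> nat" where
  "pair_code e e' = (\<lambda>p. prod_encode (e (fst p), e' (snd p)))"

definition list_code :: "('a \<Rightarrow> nat) \<Rightarrow> 'a list \<Rightarrow> nat" where
  "list_code e xs = list_encode (map e xs)"

lemma recursive_fun_id: "recursive_fun (\<lambda>n. n)"
  using recursive_fun.pair[OF recursive_fun.left recursive_fun.right] by simp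

lemma recursive_fun_const: "recursive_fun (\<lambda>_. c)"
  by (induction c) (auto intro: recursive_fun.zero recursive_fun.comp[OF recursive_fun.succ])

text \<open>Primitive recursion whose depth \<open>k n\<close> and start value \<open>f n\<close> both depend on \<open>n\<close>; the
  primitive recursion rule takes parameter and depth from a pair, so it is composed with \<open>n \<mapsto> (n, k n)\<close>.\<close>

lemma recursive_fun_iterate:
  assumes "recursive_fun f" "recursive_fun g" "recursive_fun k"
  shows "recursive_fun (\<lambda>n. rec_nat (f n) (\<lambda>i y. g (prod_encode (n, prod_encode (i, y)))) (k n))"
  using recursive_fun.comp[OF recursive_fun.prec[OF assms(1,2)]
      recursive_fun.pair[OF recursive_fun_id assms(3)]]
  by simp

lemma recursive_via_id_iff: "recursive_via id id f \<longleftrightarrow> recursive_fun f"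
  by (simp add: recursive_via_def flip: fun_eq_iff)

lemma recursive_via_id: "recursive_via e e (\<lambda>x. x)"
  unfolding recursive_via_def by (rule exI[of _ "\<lambda>n. n"]) (simp add: recursive_fun_id)

lemma recursive_via_const: "recursive_via e e' (\<lambda>_. c)"
  unfolding recursive_via_def
  by (rule exI[of _ "\<lambda>_. e' c"]) (simp add: recursive_fun_const)

lemma recursive_via_comp:
  assumes "recursive_via e1 e2 F" "recursive_via e0 e1 G"
  shows "recursive_via e0 e2 (\<lambda>x. F (G x))"
proof -
  obtain f g where "recursive_fun f" "\<forall>x. f (e1 x) = e2 (F x)"
      "recursive_fun g" "\<forall>x. g (e0 x) = e1 (G x)"
    using assms unfolding recursive_via_def by blast
  then show ?thesis
    unfolding recursive_via_def by (intro exI[of _ "\<lambda>n. f (g n)"]) (simp add: recursive_fun.comp)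
qed

lemma recursive_via_pair:
  assumes "recursive_via e e1 F" "recursive_via e e2 G"
  shows "recursive_via e (pair_code e1 e2) (\<lambda>x. (F x, G x))"
proof -
  obtain f g where "recursive_fun f" "\<forall>x. f (e x) = e1 (F x)"
      "recursive_fun g" "\<forall>x. g (e x) = e2 (G x)"
    using assms unfolding recursive_via_def by blast
  then show ?thesis
    unfolding recursive_via_def
    by (intro exI[of _ "\<lambda>n. prod_encode (f n, g n)"]) (simp add: recursive_fun.pair pair_code_def)
qed

lemma recursive_via_fst:
  assumes "recursive_via e (pair_code e1 e2) F"
  shows "recursive_via e e1 (\<lambda>x. fst (F x))"
proof (rule recursive_via_comp[OF _ assms])
  show "recursive_via (pair_code e1 e2) e1 fst"
    unfolding recursive_via_def pair_code_def
    by (rule exI[of _ "\<lambda>n. fst (prod_decode n)"]) (simp add: recursive_fun.left)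
qed

lemma recursive_via_snd:
  assumes "recursive_via e (pair_code e1 e2) F"
  shows "recursive_via e e2 (\<lambda>x. snd (F x))"
proof (rule recursive_via_comp[OF _ assms])
  show "recursive_via (pair_code e1 e2) e2 snd"
    unfolding recursive_via_def pair_code_def
    by (rule exI[of _ "\<lambda>n. snd (prod_decode n)"]) (simp add: recursive_fun.right)
qed

lemma recursive_via_Suc:
  assumes "recursive_via e id F"
  shows "recursive_via e id (\<lambda>x. Suc (F x))"
proof (rule recursive_via_comp[OF _ assms])
  show "recursive_via id id Suc"
    unfolding recursive_via_def by (rule exI[of _ Suc]) (simp add: recursive_fun.succ)
qed

lemma recursive_via_iterate:
  assumes F: "recursive_via e e' F" and K: "recursive_via e id K"
    and G: "recursive_via (pair_code e e') e' (\<lambda>p. G (fst p) (snd p))"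
  shows "recursive_via e e' (\<lambda>x. (G x ^^ K x) (F x))"
proof -
  obtain f g k where f: "recursive_fun f" "\<And>x. f (e x) = e' (F x)"
    and g: "recursive_fun g" "\<And>x y. g (prod_encode (e x, e' y)) = e' (G x y)"
    and k: "recursive_fun k" "\<And>x. k (e x) = K x"
    using assms unfolding recursive_via_def pair_code_def by auto
  define s where "s n = g (prod_encode (fst (prod_decode n), snd (prod_decode (snd (prod_decode n)))))"
    for n
  have s: "recursive_fun s"
    unfolding s_def
    by (intro recursive_fun.comp[OF g(1)] recursive_fun.pair recursive_fun.left
        recursive_fun.comp[OF recursive_fun.right recursive_fun.right])
  have "rec_nat (f (e x)) (\<lambda>i y. s (prod_encode (e x, prod_encode (i, y)))) m = e' ((G x ^^ m) (F x))"
    for x m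
    by (induction m) (simp_all add: s_def f g)
  then show ?thesis
    unfolding recursive_via_def
    by (intro exI[of _ "\<lambda>n. rec_nat (f n) (\<lambda>i y. s (prod_encode (n, prod_encode (i, y)))) (k n)"])
      (simp add: recursive_fun_iterate f(1) s k)
qed

text \<open>A conditional is an iteration: applying a constant function \<open>K x\<close> times
  replaces the start value exactly if \<open>K x\<close> is not zero.\<close>

lemma recursive_via_if_zero:
  assumes K: "recursive_via e id K" and F: "recursive_via e e' F" and G: "recursive_via e e' G"
  shows "recursive_via e e' (\<lambda>x. if K x = 0 then F x else G x)"
proof -
  have "recursive_via e e' (\<lambda>x. ((\<lambda>_. G x) ^^ K x) (F x))"
    by (rule recursive_via_iterate[OF F K]) (rule recursive_via_comp[OF G recursive_via_fst[OF recursive_via_id]])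
  moreover have "((\<lambda>_. G x) ^^ K x) (F x) = (if K x = 0 then F x else G x)" for x
    by (cases "K x") simp_all
  ultimately show ?thesis by simp
qed

lemma recursive_via_add:
  assumes "recursive_via e id K" "recursive_via e id M"
  shows "recursive_via e id (\<lambda>x. K x + M x)"
proof -
  have "recursive_via e id (\<lambda>x. (Suc ^^ K x) (M x))"
    by (rule recursive_via_iterate[OF assms(2,1)])
      (rule recursive_via_Suc[OF recursive_via_snd[OF recursive_via_id]])
  then show ?thesis by simp
qed

lemma recursive_via_not:
  assumes "recursive_via e of_bool P"
  shows "recursive_via e of_bool (\<lambda>x. \<not> P x)"
proof (rule recursive_via_comp[OF _ assms])
  have "recursive_via id id (\<lambda>n::nat. if n = 0 then 1 else 0 :: nat)"
    by (intro recursive_via_if_zero recursive_via_id recursive_via_const)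
  then obtain f where "recursive_fun f" "\<And>n. f n = (if n = 0 then 1 else 0)"
    unfolding recursive_via_def by auto
  then show "recursive_via of_bool of_bool Not"
    unfolding recursive_via_def by (intro exI[of _ f]) auto
qed

text \<open>In a primitive recursion of depth \<open>n\<close>, the last step sees the index \<open>n - 1\<close>.\<close>

lemma recursive_fun_pred: "recursive_fun (\<lambda>n. n - 1)"
proof -
  have "recursive_fun (\<lambda>n. rec_nat 0 (\<lambda>i y. fst (prod_decode (snd (prod_decode
      (prod_encode (n, prod_encode (i, y))))))) n)"
    by (rule recursive_fun_iterate[OF recursive_fun.zero
          recursive_fun.comp[OF recursive_fun.left recursive_fun.right] recursive_fun_id])
  moreover have "rec_nat 0 (\<lambda>i y. i) n = n - 1" for n
    by (cases n) simp_all
  ultimately show ?thesis by simp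
qed

lemma recursive_via_Cons:
  assumes "recursive_via e ea F" "recursive_via e (list_code ea) Xs"
  shows "recursive_via e (list_code ea) (\<lambda>x. F x # Xs x)"
proof -
  obtain f where "recursive_fun f" "\<forall>x. f (e x) = pair_code ea (list_code ea) (F x, Xs x)"
    using recursive_via_pair[OF assms] unfolding recursive_via_def by auto
  then show ?thesis
    unfolding recursive_via_def
    by (intro exI[of _ "\<lambda>n. Suc (f n)"])
      (simp add: recursive_fun.comp[OF recursive_fun.succ] pair_code_def list_code_def)
qed

text \<open>The code of \<open>[]\<close> is zero, and that of \<open>y # ys\<close> is the successor of the code of \<open>(y, ys)\<close>;
  hence a case distinction is a test for zero followed by a predecessor.\<close>

lemma recursive_via_case_list:
  assumes Xs: "recursive_via e (list_code ea) Xs" and A: "recursive_via e e' A"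
    and B: "recursive_via (pair_code e (pair_code ea (list_code ea))) e'
      (\<lambda>p. B (fst p) (fst (snd p)) (snd (snd p)))"
  shows "recursive_via e e' (\<lambda>x. case Xs x of [] \<Rightarrow> A x | y # ys \<Rightarrow> B x y ys)"
proof -
  obtain xs a b where xs: "recursive_fun xs" "\<And>x. xs (e x) = list_code ea (Xs x)"
    and a: "recursive_fun a" "\<And>x. a (e x) = e' (A x)"
    and b: "recursive_fun b"
      "\<And>x y ys. b (prod_encode (e x, prod_encode (ea y, list_code ea ys))) = e' (B x y ys)"
    using assms unfolding recursive_via_def pair_code_def by auto
  define c where "c n = b (prod_encode (n, xs n - 1))" for n
  have c: "recursive_fun c"
    unfolding c_def
    by (intro recursive_fun.comp[OF b(1)] recursive_fun.pair recursive_fun_id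
        recursive_fun.comp[OF recursive_fun_pred xs(1)])
  have "recursive_fun (\<lambda>n. if xs n = 0 then a n else c n)"
    using xs(1) a(1) c recursive_via_if_zero[of id xs id a c] by (simp add: recursive_via_id_iff)
  moreover have "(if xs (e x) = 0 then a (e x) else c (e x)) =
      e' (case Xs x of [] \<Rightarrow> A x | y # ys \<Rightarrow> B x y ys)" for x
    using b(2)[of x] by (simp add: xs(2) a(2) c_def list_code_def split: list.split)
  ultimately show ?thesis
    unfolding recursive_via_def by blast
qed

lemmas recursive_via_basics = recursive_via_id recursive_via_pair recursive_via_Cons
  recursive_via_fst recursive_via_snd recursive_via_const recursive_via_Suc recursive_via_add

lemma length_le_list_encode: "length xs \<le> list_encode xs"
proof (induction xs)
  case (Cons x xs)
  then show ?case using le_prod_encode_2[of "list_encode xs" x] by simp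
qed simp

text \<open>A fold iterates the step that moves one entry of the remaining list into the accumulator.
  Steps after the list is exhausted change nothing, so any upper bound on the length may serve as
  the number of iterations; the code of the list is one.\<close>

lemma recursive_via_foldl:
  assumes Xs: "recursive_via e (list_code ea) Xs" and A: "recursive_via e e' A"
    and G: "recursive_via (pair_code e (pair_code e' ea)) e'
      (\<lambda>p. G (fst p) (fst (snd p)) (snd (snd p)))"
  shows "recursive_via e e' (\<lambda>x. foldl (G x) (A x) (Xs x))"
proof -
  define step where "step x s = (case snd s of [] \<Rightarrow> s | y # ys \<Rightarrow> (G x (fst s) y, ys))" for x s
  have fold: "fst ((step x ^^ k) (a, xs)) = foldl (G x) a xs" if "length xs \<le> k" for x a xs k
    using that
  proof (induction k arbitrary: a xs)
    case (Suc k)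
    then show ?case
      by (cases xs) (auto simp: step_def funpow_Suc_right simp del: funpow.simps)
  qed simp
  have len: "recursive_via e id (\<lambda>x. list_code ea (Xs x))"
    using Xs unfolding recursive_via_def by simp
  have "recursive_via (pair_code e (pair_code e' (list_code ea))) (pair_code e' (list_code ea))
      (\<lambda>p. case snd (snd p) of [] \<Rightarrow> snd p | y # ys \<Rightarrow> (G (fst p) (fst (snd p)) y, ys))"
  proof (rule recursive_via_case_list)
    let ?e = "pair_code (pair_code e (pair_code e' (list_code ea))) (pair_code ea (list_code ea))"
    have "recursive_via ?e e' (\<lambda>q. (\<lambda>p. G (fst p) (fst (snd p)) (snd (snd p)))
        (fst (fst q), fst (snd (fst q)), fst (snd q)))"
      by (rule recursive_via_comp[OF G])
        (rule recursive_via_basics)+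
    then have "recursive_via ?e e' (\<lambda>q. G (fst (fst q)) (fst (snd (fst q))) (fst (snd q)))"
      by simp
    then show "recursive_via ?e (pair_code e' (list_code ea))
        (\<lambda>q. (G (fst (fst q)) (fst (snd (fst q))) (fst (snd q)), snd (snd q)))"
      by (rule recursive_via_pair) (rule recursive_via_basics)+
  qed (rule recursive_via_basics)+
  then have "recursive_via e (pair_code e' (list_code ea))
      (\<lambda>x. (step x ^^ list_code ea (Xs x)) (A x, Xs x))"
    by (intro recursive_via_iterate[OF recursive_via_pair[OF A Xs] len]) (simp add: step_def)
  then have "recursive_via e e' (\<lambda>x. fst ((step x ^^ list_code ea (Xs x)) (A x, Xs x)))"
    by (rule recursive_via_fst)
  moreover have "length (Xs x) \<le> list_code ea (Xs x)" for x
    using length_le_list_encode[of "map ea (Xs x)"] by (simp add: list_code_def)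
  ultimately show ?thesis by (simp add: fold)
qed

lemma recursive_via_rev:
  assumes "recursive_via e (list_code ea) Xs"
  shows "recursive_via e (list_code ea) (\<lambda>x. rev (Xs x))"
proof -
  have "recursive_via e (list_code ea) (\<lambda>x. foldl (\<lambda>acc y. y # acc) [] (Xs x))"
    by (rule recursive_via_foldl[OF assms] recursive_via_basics)+
  moreover have "foldl (\<lambda>acc y. y # acc) ys xs = rev xs @ ys" for xs ys :: "'b list"
    by (induction xs arbitrary: ys) simp_all
  ultimately show ?thesis by simp
qed

lemma recursive_via_append:
  assumes "recursive_via e (list_code ea) Xs" "recursive_via e (list_code ea) Ys"
  shows "recursive_via e (list_code ea) (\<lambda>x. Xs x @ Ys x)"
proof -
  have "recursive_via e (list_code ea) (\<lambda>x. foldl (\<lambda>acc y. y # acc) (Ys x) (rev (Xs x)))"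
    by (rule recursive_via_foldl[OF recursive_via_rev[OF assms(1)] assms(2)] recursive_via_basics)+
  moreover have "foldl (\<lambda>acc y. y # acc) ys xs = rev xs @ ys" for xs ys :: "'b list"
    by (induction xs arbitrary: ys) simp_all
  ultimately show ?thesis by simp
qed

lemma recursive_via_map:
  assumes Xs: "recursive_via e (list_code ea) Xs"
    and G: "recursive_via (pair_code e ea) eb (\<lambda>p. G (fst p) (snd p))"
  shows "recursive_via e (list_code eb) (\<lambda>x. map (G x) (Xs x))"
proof -
  have G': "recursive_via (pair_code e (pair_code (list_code eb) ea)) eb
      (\<lambda>p. (\<lambda>q. G (fst q) (snd q)) (fst p, snd (snd p)))"
    by (rule recursive_via_comp[OF G])
      (rule recursive_via_basics)+
  have "recursive_via e (list_code eb) (\<lambda>x. rev (foldl (\<lambda>acc y. G x y # acc) [] (Xs x)))"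
    by (rule recursive_via_rev recursive_via_foldl[OF Xs] recursive_via_Cons recursive_via_const
        G'[simplified] recursive_via_fst recursive_via_snd recursive_via_id)+
  moreover have "foldl (\<lambda>acc y. G x y # acc) zs ys = rev (map (G x) ys) @ zs" for x ys zs
    by (induction ys arbitrary: zs) simp_all
  ultimately show ?thesis by simp
qed

text \<open>A fold over the first list whose state carries the rest of the second one.\<close>

lemma recursive_via_zip:
  assumes Xs: "recursive_via e (list_code ea) Xs" and Ys: "recursive_via e (list_code eb) Ys"
  shows "recursive_via e (list_code (pair_code ea eb)) (\<lambda>x. zip (Xs x) (Ys x))"
proof -
  define step :: "('b \<times> 'c) list \<times> 'c list \<Rightarrow> 'b \<Rightarrow> ('b \<times> 'c) list \<times> 'c list" where
    "step s x = (case snd s of [] \<Rightarrow> s | y # ys \<Rightarrow> ((x, y) # fst s, ys))" for s x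
  let ?st = "pair_code (list_code (pair_code ea eb)) (list_code eb)"
  have "recursive_via (pair_code e (pair_code ?st ea)) ?st
      (\<lambda>p. case snd (fst (snd p)) of [] \<Rightarrow> fst (snd p)
         | y # ys \<Rightarrow> ((snd (snd p), y) # fst (fst (snd p)), ys))"
    by (rule recursive_via_case_list)
      (rule recursive_via_basics)+
  then have "recursive_via e ?st (\<lambda>x. foldl step ([], Ys x) (Xs x))"
    by (intro recursive_via_foldl[OF Xs] recursive_via_pair recursive_via_const Ys)
      (simp add: step_def)
  then have "recursive_via e (list_code (pair_code ea eb))
      (\<lambda>x. rev (fst (foldl step ([], Ys x) (Xs x))))"
    by (intro recursive_via_rev recursive_via_fst)
  moreover have "fst (foldl step (zs, ys) xs) = rev (zip xs ys) @ zs" for xs ys zs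
  proof (induction xs arbitrary: ys zs)
    case (Cons x xs)
    have "foldl step (zs, []) xs = (zs, [])" for xs zs
      by (induction xs) (simp_all add: step_def)
    with Cons show ?case by (cases ys) (simp_all add: step_def)
  qed simp
  ultimately show ?thesis by simp
qed

section \<open>The combined presentation\<close>

definition inverse_word :: "'x word \<Rightarrow> 'x word" where
  "inverse_word w = rev (map (\<lambda>l. (fst l, \<not> snd l)) w)"

definition shift_word :: "nat \<Rightarrow> nat word \<Rightarrow> nat word" where
  "shift_word k w = map (\<lambda>l. (k + fst l, snd l)) w"

definition conjugate_word :: "'x word \<Rightarrow> 'x word \<Rightarrow> 'x word" where
  "conjugate_word u w = u @ w @ inverse_word u"

text \<open>The generators of the first presentation keep their numbers, those of the second one are shifted
  by \<open>data_gens d1\<close>, and the two stable letters take the next two numbers.\<close>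

definition stable_letter_1 :: "overgroup_data \<Rightarrow> overgroup_data \<Rightarrow> nat \<times> bool" where
  "stable_letter_1 d1 d2 = (data_gens d1 + data_gens d2, True)"

definition stable_letter_2 :: "overgroup_data \<Rightarrow> overgroup_data \<Rightarrow> nat \<times> bool" where
  "stable_letter_2 d1 d2 = (Suc (data_gens d1 + data_gens d2), True)"

text \<open>Besides the relators of the two given groups: one relator for each generator of \<open>G\<close>, identifying
  its two images, and one commutation relator for each generator of the two given subgroups.\<close>

definition amalgam_rels :: "overgroup_data \<Rightarrow> overgroup_data \<Rightarrow> nat word list" where
  "amalgam_rels d1 d2 =
    data_rels d1 @ map (shift_word (data_gens d1)) (data_rels d2) @
    map (\<lambda>p. fst p @ inverse_word (shift_word (data_gens d1) (snd p)))
      (zip (data_emb d1) (data_emb d2)) @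
    map (\<lambda>w. conjugate_word [stable_letter_1 d1 d2] w @ inverse_word w) (data_sub d1) @
    map (\<lambda>w. conjugate_word [stable_letter_2 d1 d2] w @ inverse_word w)
      (map (shift_word (data_gens d1)) (data_sub d2))"

definition amalgam_data ::
  "overgroup_data \<Rightarrow> overgroup_data \<Rightarrow> nat word list \<Rightarrow> overgroup_data" where
  "amalgam_data d1 d2 ws =
    Overgroup_Data (Suc (Suc (data_gens d1 + data_gens d2))) (amalgam_rels d1 d2) (data_emb d1) ws"

definition intersection_data :: "overgroup_data \<Rightarrow> overgroup_data \<Rightarrow> overgroup_data" where
  "intersection_data d1 d2 = amalgam_data d1 d2
    (map (conjugate_word [stable_letter_1 d1 d2, stable_letter_2 d1 d2]) (data_emb d1))"

definition join_data :: "overgroup_data \<Rightarrow> overgroup_data \<Rightarrow> overgroup_data" where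
  "join_data d1 d2 = amalgam_data d1 d2
    (map (conjugate_word [stable_letter_1 d1 d2]) (data_emb d1) @
     map (conjugate_word [stable_letter_2 d1 d2]) (data_emb d1))"

text \<open>The value at the empty list is arbitrary.\<close>

definition fold_data ::
  "(overgroup_data \<Rightarrow> overgroup_data \<Rightarrow> overgroup_data) \<Rightarrow> overgroup_data list \<Rightarrow> overgroup_data"
where
  "fold_data F ds = (case ds of [] \<Rightarrow> Overgroup_Data 0 [] [] [] | d # ds' \<Rightarrow> foldl F d ds')"

section \<open>Computability of the combined presentation\<close>

abbreviation letter_code :: "nat \<times> bool \<Rightarrow> nat" where
  "letter_code \<equiv> pair_code id of_bool"

lemma word_code_eq: "word_code = list_code letter_code"
  by (simp add: fun_eq_iff word_code_def list_code_def pair_code_def case_prod_unfold)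

lemma word_list_code_eq: "word_list_code = list_code word_code"
  by (simp add: fun_eq_iff word_list_code_def list_code_def)

lemma data_code_eq:
  "data_code d = pair_code id (pair_code word_list_code (pair_code word_list_code word_list_code))
    (data_gens d, data_rels d, data_emb d, data_sub d)"
  by (simp add: data_code_def pair_code_def)

lemma recursive_via_data_fields:
  assumes "recursive_via e data_code D"
  shows "recursive_via e (pair_code id (pair_code word_list_code (pair_code word_list_code word_list_code)))
    (\<lambda>x. (data_gens (D x), data_rels (D x), data_emb (D x), data_sub (D x)))"
  using assms by (simp add: recursive_via_def data_code_eq)

lemma recursive_via_data:
  assumes "recursive_via e data_code D"
  shows recursive_via_data_gens: "recursive_via e id (\<lambda>x. data_gens (D x))"
    and recursive_via_data_rels:
      "recursive_via e (list_code (list_code letter_code)) (\<lambda>x. data_rels (D x))"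
    and recursive_via_data_emb:
      "recursive_via e (list_code (list_code letter_code)) (\<lambda>x. data_emb (D x))"
    and recursive_via_data_sub:
      "recursive_via e (list_code (list_code letter_code)) (\<lambda>x. data_sub (D x))"
  using recursive_via_fst[OF recursive_via_data_fields[OF assms]]
    recursive_via_fst[OF recursive_via_snd[OF recursive_via_data_fields[OF assms]]]
    recursive_via_fst[OF recursive_via_snd[OF recursive_via_snd[OF recursive_via_data_fields[OF assms]]]]
    recursive_via_snd[OF recursive_via_snd[OF recursive_via_snd[OF recursive_via_data_fields[OF assms]]]]
  by (simp_all add: word_list_code_eq word_code_eq)

lemma recursive_via_Overgroup_Data:
  assumes "recursive_via e id N" "recursive_via e (list_code (list_code letter_code)) R"
    "recursive_via e (list_code (list_code letter_code)) E"
    "recursive_via e (list_code (list_code letter_code)) S"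
  shows "recursive_via e data_code (\<lambda>x. Overgroup_Data (N x) (R x) (E x) (S x))"
  using recursive_via_pair[OF assms(1) recursive_via_pair[OF assms(2) recursive_via_pair[OF assms(3,4)]]]
  by (simp add: recursive_via_def data_code_eq word_list_code_eq word_code_eq)

lemmas recursive_via_rules = recursive_via_basics recursive_via_not recursive_via_append
  recursive_via_rev recursive_via_map recursive_via_zip recursive_via_data
  recursive_via_Overgroup_Data

text \<open>The data are built from projections, arithmetic and list operations only, so the closure
  rules follow the term structure.\<close>

lemma recursive_via_intersection_data:
  "recursive_via (pair_code data_code data_code) data_code (\<lambda>p. intersection_data (fst p) (snd p))"
  unfolding intersection_data_def amalgam_data_def amalgam_rels_def stable_letter_1_def
    stable_letter_2_def conjugate_word_def inverse_word_def shift_word_def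
  by (rule recursive_via_rules)+

lemma recursive_via_join_data:
  "recursive_via (pair_code data_code data_code) data_code (\<lambda>p. join_data (fst p) (snd p))"
  unfolding join_data_def amalgam_data_def amalgam_rels_def stable_letter_1_def
    stable_letter_2_def conjugate_word_def inverse_word_def shift_word_def
  by (rule recursive_via_rules)+

lemma computable_fold_data:
  assumes "recursive_via (pair_code data_code data_code) data_code (\<lambda>p. F (fst p) (snd p))"
  shows "computable (fold_data F)"
proof -
  let ?l = "list_code data_code"
  let ?e = "pair_code (pair_code ?l (pair_code data_code ?l)) (pair_code data_code data_code)"
  have "recursive_via ?e data_code (\<lambda>q. (\<lambda>p. F (fst p) (snd p)) (snd q))"
    by (rule recursive_via_comp[OF assms]) (rule recursive_via_basics)+
  then have "recursive_via ?l data_code (fold_data F)"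
    unfolding fold_data_def
    by - (rule recursive_via_case_list recursive_via_foldl recursive_via_basics | simp)+
  then show ?thesis
    by (simp add: computable_def recursive_via_def list_code_def)
qed

section \<open>Words and presented groups\<close>

primrec word_value :: "('a, 'b) monoid_scheme \<Rightarrow> ('x \<Rightarrow> 'a) \<Rightarrow> 'x word \<Rightarrow> 'a" where
  "word_value G f [] = \<one>\<^bsub>G\<^esub>"
| "word_value G f (l # w) =
    (if snd l then f (fst l) else inv\<^bsub>G\<^esub> f (fst l)) \<otimes>\<^bsub>G\<^esub> word_value G f w"

lemma words_Cons [simp]: "l # w \<in> words X \<longleftrightarrow> fst l \<in> X \<and> w \<in> words X"
  by (cases l) (auto simp: words_def)

lemma words_mono: "w \<in> words X \<Longrightarrow> X \<subseteq> Y \<Longrightarrow> w \<in> words Y"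
  by (induction w) auto

lemma inverse_word_simps [simp]:
  "inverse_word [] = []"
  "inverse_word (l # w) = inverse_word w @ [(fst l, \<not> snd l)]"
  by (simp_all add: inverse_word_def)

lemma inverse_word_words [simp]: "inverse_word w \<in> words X \<longleftrightarrow> w \<in> words X"
  by (induction w) auto

lemma conjugate_word_words [simp]:
  "conjugate_word u w \<in> words X \<longleftrightarrow> u \<in> words X \<and> w \<in> words X"
  by (auto simp: conjugate_word_def)

lemma shift_word_words: "w \<in> words {..<n} \<Longrightarrow> k + n \<le> m \<Longrightarrow> shift_word k w \<in> words {..<m}"
  unfolding shift_word_def by (induction w) auto

lemma word_value_cong:
  "(\<And>x. x \<in> X \<Longrightarrow> f x = g x) \<Longrightarrow> w \<in> words X \<Longrightarrow> word_value G f w = word_value G g w"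
  by (induction w) auto

lemma word_value_shift: "word_value G f (shift_word k w) = word_value G (\<lambda>x. f (k + x)) w"
  unfolding shift_word_def by (induction w) auto

context group
begin

lemma word_value_closed [simp]: "f \<in> X \<rightarrow> carrier G \<Longrightarrow> w \<in> words X \<Longrightarrow> word_value G f w \<in> carrier G"
  by (induction w) auto

lemma word_value_append:
  "f \<in> X \<rightarrow> carrier G \<Longrightarrow> u \<in> words X \<Longrightarrow> v \<in> words X \<Longrightarrow>
    word_value G f (u @ v) = word_value G f u \<otimes> word_value G f v"
proof (induction u)
  case (Cons l u)
  then have "f (fst l) \<in> carrier G" by auto
  with Cons show ?case by (simp add: m_assoc)
qed simp

lemma word_value_inverse:
  assumes f: "f \<in> X \<rightarrow> carrier G" and w: "w \<in> words X"
  shows "word_value G f (inverse_word w) = inv word_value G f w"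
  using w
proof (induction w)
  case (Cons l w)
  then have "f (fst l) \<in> carrier G" using f by auto
  with Cons show ?case
    using f by (auto simp: word_value_append[OF f] inv_mult_group)
qed simp

lemma word_value_conjugate:
  "f \<in> X \<rightarrow> carrier G \<Longrightarrow> u \<in> words X \<Longrightarrow> w \<in> words X \<Longrightarrow>
    word_value G f (conjugate_word u w) =
      word_value G f u \<otimes> word_value G f w \<otimes> inv word_value G f u"
  by (simp add: conjugate_word_def word_value_append word_value_inverse m_assoc)

lemma word_value_free_equiv:
  assumes f: "f \<in> X \<rightarrow> carrier G"
  shows "(u, v) \<in> free_equiv X \<Longrightarrow> word_value G f u = word_value G f v"
proof (induction rule: free_equiv.induct)
  case (cancel u v x b)
  then have fx: "f x \<in> carrier G" using f by auto
  have "f x \<otimes> (inv f x \<otimes> word_value G f v) = word_value G f v"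
    "inv f x \<otimes> (f x \<otimes> word_value G f v) = word_value G f v"
    using cancel fx f by (simp_all flip: m_assoc)
  with cancel show ?case by (cases b) (simp_all add: word_value_append[OF f])
qed auto

end

lemma (in group_hom) hom_word_value:
  assumes f: "f \<in> X \<rightarrow> carrier G" and w: "w \<in> words X"
  shows "h (word_value G f w) = word_value H (\<lambda>x. h (f x)) w"
  using w
proof (induction w)
  case (Cons l w)
  then have "f (fst l) \<in> carrier G" using f by auto
  with Cons f show ?case by auto
qed simp

lemma normal_relator_closure:
  "R \<subseteq> words X \<Longrightarrow> relator_closure X R \<lhd> free_group X"
  by (rule normal_normal_closure[OF group_free_group]) (auto simp: carrier_free_group)

lemma free_class_closed [simp]: "w \<in> words X \<Longrightarrow> free_class X w \<in> carrier (free_group X)"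
  by (simp add: carrier_free_group)

lemma carrier_presented_group: "carrier (presented_group X R) = word_elem X R ` words X"
  by (auto simp: presented_group_def carrier_FactGroup carrier_free_group word_elem_def)

lemma mult_word_elem:
  assumes "R \<subseteq> words X" "u \<in> words X" "v \<in> words X"
  shows "word_elem X R u \<otimes>\<^bsub>presented_group X R\<^esub> word_elem X R v = word_elem X R (u @ v)"
  using assms normal.rcos_sum[OF normal_relator_closure[OF assms(1)], of "free_class X u" "free_class X v"]
  by (simp add: presented_group_def word_elem_def mult_free_class)

lemma word_elem_Nil:
  assumes "R \<subseteq> words X"
  shows "word_elem X R [] = \<one>\<^bsub>presented_group X R\<^esub>"
proof -
  interpret normal "relator_closure X R" "free_group X"
    by (rule normal_relator_closure[OF assms])
  show ?thesis
    using coset_mult_one[OF subset]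
    by (simp add: presented_group_def word_elem_def flip: one_free_group)
qed

lemma word_elem_relator:
  assumes "R \<subseteq> words X" "r \<in> R"
  shows "word_elem X R r = \<one>\<^bsub>presented_group X R\<^esub>"
proof -
  interpret normal "relator_closure X R" "free_group X"
    by (rule normal_relator_closure[OF assms(1)])
  have "free_class X r \<in> relator_closure X R"
    using assms(2) by (auto simp: normal_closure_def)
  then show ?thesis
    by (simp add: presented_group_def word_elem_def coset_join2 subgroup_axioms mem_carrier)
qed

lemma word_elem_eq_word_value:
  assumes R: "R \<subseteq> words X" and w: "w \<in> words X"
  shows "word_elem X R w = word_value (presented_group X R) (\<lambda>x. word_elem X R [(x, True)]) w"
  using w
proof (induction w)
  case Nil
  then show ?case by (simp add: word_elem_Nil[OF R])
next
  case (Cons l w)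
  interpret group "presented_group X R" by (rule group_presented_group[OF R])
  obtain x b where l: "l = (x, b)" and x: "x \<in> X" using Cons.prems by (cases l) auto
  have cl: "word_elem X R [(x, c)] \<in> carrier (presented_group X R)" for c
    using x by (simp add: carrier_presented_group)
  have "([] @ [(x, False), (x, \<not> False)] @ [], [] @ []) \<in> free_equiv X"
    using x by (intro free_equiv.cancel) auto
  then have "free_class X [(x, False), (x, True)] = free_class X []"
    using x by (subst free_class_eq_iff) auto
  then have "word_elem X R [(x, False)] \<otimes>\<^bsub>presented_group X R\<^esub> word_elem X R [(x, True)] = \<one>\<^bsub>presented_group X R\<^esub>"
    using x mult_word_elem[OF R] word_elem_Nil[OF R] by (simp add: word_elem_def)
  then have "inv\<^bsub>presented_group X R\<^esub> word_elem X R [(x, True)] = word_elem X R [(x, False)]"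
    using cl inv_equality by blast
  moreover have "word_elem X R (l # w) = word_elem X R [(x, b)] \<otimes>\<^bsub>presented_group X R\<^esub> word_elem X R w"
    using Cons.prems x mult_word_elem[OF R, of "[(x, b)]" w] by (simp add: l)
  ultimately show ?case using Cons by (cases b) (simp_all add: l)
qed

text \<open>Von Dyck's theorem: evaluation of words is well defined on the free group, and its kernel is a
  normal subgroup containing the relators, hence their normal closure.\<close>

theorem presented_group_universal:
  assumes H: "group H" and R: "R \<subseteq> words X" and f: "f \<in> X \<rightarrow> carrier H"
    and rel: "\<And>r. r \<in> R \<Longrightarrow> word_value H f r = \<one>\<^bsub>H\<^esub>"
  obtains h where "h \<in> hom (presented_group X R) H"
    "\<And>w. w \<in> words X \<Longrightarrow> h (word_elem X R w) = word_value H f w"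
proof -
  interpret H: group H by fact
  interpret F: group "free_group X" by (rule group_free_group)
  define g where "g A = the_elem (word_value H f ` A)" for A
  have g: "g (free_class X w) = word_value H f w" if "w \<in> words X" for w
  proof -
    have "word_value H f ` free_class X w = {word_value H f w}"
      using H.word_value_free_equiv[OF f] that
      by (auto simp: free_class_def intro!: image_eqI[of _ _ w] free_equiv.refl)
    then show ?thesis by (simp add: g_def)
  qed
  have g_hom: "g \<in> hom (free_group X) H"
    using f by (auto simp: hom_def carrier_free_group g mult_free_class H.word_value_append)
  interpret g: group_hom "free_group X" H g
    by unfold_locales (rule g_hom)
  have "relator_closure X R \<subseteq> kernel (free_group X) H g"
    unfolding normal_closure_def
    using g.normal_kernel R rel by (intro Inter_lower) (auto simp: kernel_def g subset_iff)
  then obtain h where h: "h \<in> hom (free_group X Mod relator_closure X R) H"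
      "\<And>x. x \<in> carrier (free_group X) \<Longrightarrow> h (relator_closure X R #>\<^bsub>free_group X\<^esub> x) = g x"
    using g.FactGroup_universal_kernel[OF normal_relator_closure[OF R]] by blast
  show ?thesis
    by (rule that[of h]) (simp_all add: presented_group_def word_elem_def h g)
qed

section \<open>Permutation groups\<close>

lemma BijGroup_mult_apply:
  "f \<in> carrier (BijGroup S) \<Longrightarrow> g \<in> carrier (BijGroup S) \<Longrightarrow> x \<in> S \<Longrightarrow>
    (f \<otimes>\<^bsub>BijGroup S\<^esub> g) x = f (g x)"
  by (simp add: BijGroup_def compose_def)

lemma BijGroup_eqI:
  "f \<in> carrier (BijGroup S) \<Longrightarrow> g \<in> carrier (BijGroup S) \<Longrightarrow> (\<And>x. x \<in> S \<Longrightarrow> f x = g x) \<Longrightarrow> f = g"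
  by (auto simp: BijGroup_def Bij_def intro: extensionalityI)

lemma BijGroup_closed: "f \<in> carrier (BijGroup S) \<Longrightarrow> x \<in> S \<Longrightarrow> f x \<in> S"
  by (auto simp: BijGroup_def Bij_def bij_betw_def)

lemma BijGroup_commuteI:
  assumes f: "restrict f S \<in> carrier (BijGroup S)" and g: "restrict g S \<in> carrier (BijGroup S)"
    and comm: "\<And>x. x \<in> S \<Longrightarrow> f (g x) = g (f x)"
  shows "restrict f S \<otimes>\<^bsub>BijGroup S\<^esub> restrict g S = restrict g S \<otimes>\<^bsub>BijGroup S\<^esub> restrict f S"
proof -
  interpret group "BijGroup S" by (rule group_BijGroup)
  show ?thesis
    using BijGroup_closed[OF f] BijGroup_closed[OF g] comm
    by (intro BijGroup_eqI[where S = S]) (auto simp: BijGroup_mult_apply f g)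
qed

lemma BijGroup_memI:
  assumes "\<And>x. x \<in> S \<Longrightarrow> f x \<in> S" "\<And>x. x \<in> S \<Longrightarrow> g x \<in> S"
    "\<And>x. x \<in> S \<Longrightarrow> f (g x) = x" "\<And>x. x \<in> S \<Longrightarrow> g (f x) = x"
  shows "restrict f S \<in> carrier (BijGroup S)"
proof -
  have "bij_betw f S S" by (rule bij_betw_byWitness[of _ g]) (use assms in auto)
  then show ?thesis by (simp add: BijGroup_def Bij_def)
qed

lemma action_hom_BijGroup:
  assumes "group K"
    and closed: "\<And>k x. k \<in> carrier K \<Longrightarrow> x \<in> S \<Longrightarrow> a k x \<in> S"
    and one: "\<And>x. x \<in> S \<Longrightarrow> a \<one>\<^bsub>K\<^esub> x = x"
    and mult: "\<And>k k' x. k \<in> carrier K \<Longrightarrow> k' \<in> carrier K \<Longrightarrow> x \<in> S \<Longrightarrow> a (k \<otimes>\<^bsub>K\<^esub> k') x = a k (a k' x)"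
  shows "(\<lambda>k. restrict (a k) S) \<in> hom K (BijGroup S)"
proof -
  interpret group K by fact
  have mem: "restrict (a k) S \<in> carrier (BijGroup S)" if k: "k \<in> carrier K" for k
  proof (rule BijGroup_memI[where g = "a (inv\<^bsub>K\<^esub> k)"])
    fix x assume x: "x \<in> S"
    show "a k (a (inv\<^bsub>K\<^esub> k) x) = x" "a (inv\<^bsub>K\<^esub> k) (a k x) = x"
      using k x one mult[of k "inv\<^bsub>K\<^esub> k" x] mult[of "inv\<^bsub>K\<^esub> k" k x] by simp_all
  qed (use k closed in simp_all)
  show ?thesis
  proof (rule homI)
    fix k k' assume k: "k \<in> carrier K" "k' \<in> carrier K"
    show "restrict (a (k \<otimes>\<^bsub>K\<^esub> k')) S = restrict (a k) S \<otimes>\<^bsub>BijGroup S\<^esub> restrict (a k') S"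
      using mem[OF k(1)] mem[OF k(2)] closed mult k
      by (auto simp: BijGroup_def compose_def fun_eq_iff)
  qed (rule mem)
qed

lemma (in group) subgroup_set_mult_invariant:
  assumes L: "subgroup L G" and S: "S \<subseteq> carrier G" and l: "l \<in> L" and x: "x \<in> carrier G"
  shows "l \<otimes> x \<in> L <#> S \<longleftrightarrow> x \<in> L <#> S"
proof -
  have imp: "l \<otimes> x \<in> L <#> S" if "l \<in> L" "x \<in> L <#> S" for l x
  proof -
    obtain l' s where ls: "l' \<in> L" "s \<in> S" "x = l' \<otimes> s" using \<open>x \<in> L <#> S\<close> by (auto simp: set_mult_def)
    then have "l \<otimes> x = (l \<otimes> l') \<otimes> s"
      using \<open>l \<in> L\<close> S subgroup.subset[OF L] by (simp add: m_assoc subset_iff)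
    moreover have "l \<otimes> l' \<in> L" using L \<open>l \<in> L\<close> ls(1) by (rule subgroup.m_closed)
    ultimately show ?thesis using ls(2) by (auto simp: set_mult_def)
  qed
  have "inv l \<otimes> (l \<otimes> x) = x"
    using l x subgroup.subset[OF L] by (simp add: subset_iff flip: m_assoc)
  then show ?thesis
    using imp[of l x] imp[of "inv l" "l \<otimes> x"] l subgroup.m_inv_closed[OF L l] by auto
qed

section \<open>Two groups acting on a common set\<close>

text \<open>\<open>c k\<close> is the chosen representative of the coset of \<open>k\<close> modulo the image of \<open>G\<close>, and \<open>p k\<close> the
  \<open>G\<close>-component: \<open>k = \<phi> (p k) c k\<close>. The coset of the unit is represented by the unit, so that \<open>p\<close> is
  a left inverse of \<open>\<phi>\<close>.\<close>

locale transversal = group_hom G K \<phi>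
  for G (structure) and K (structure) and \<phi> +
  fixes p c
  assumes p_closed [simp]: "k \<in> carrier K \<Longrightarrow> p k \<in> carrier G"
    and c_closed [simp]: "k \<in> carrier K \<Longrightarrow> c k \<in> carrier K"
    and decomp: "k \<in> carrier K \<Longrightarrow> \<phi> (p k) \<otimes>\<^bsub>K\<^esub> c k = k"
    and p_mult: "g \<in> carrier G \<Longrightarrow> k \<in> carrier K \<Longrightarrow> p (\<phi> g \<otimes>\<^bsub>K\<^esub> k) = g \<otimes> p k"
    and c_mult: "g \<in> carrier G \<Longrightarrow> k \<in> carrier K \<Longrightarrow> c (\<phi> g \<otimes>\<^bsub>K\<^esub> k) = c k"
    and p_one [simp]: "p \<one>\<^bsub>K\<^esub> = \<one>"
begin

lemma p_emb [simp]: "g \<in> carrier G \<Longrightarrow> p (\<phi> g) = g"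
  using p_mult[of g "\<one>\<^bsub>K\<^esub>"] by simp

lemma inj_emb: "inj_on \<phi> (carrier G)"
  by (rule inj_on_inverseI[of _ p]) simp

lemma p_comp [simp]: "g \<in> carrier G \<Longrightarrow> k \<in> carrier K \<Longrightarrow> p (\<phi> g \<otimes>\<^bsub>K\<^esub> c k) = g"
proof -
  assume g: "g \<in> carrier G" and k: "k \<in> carrier K"
  have "p k = p k \<otimes> p (c k)"
    using k p_mult[of "p k" "c k"] by (simp add: decomp)
  then have "p (c k) = \<one>" using k by (metis G.l_cancel_one' p_closed c_closed)
  then show "p (\<phi> g \<otimes>\<^bsub>K\<^esub> c k) = g" using g k by (simp add: p_mult)
qed

text \<open>If \<open>\<phi> g = l \<phi> g'\<close> with \<open>l \<in> L\<close>, then \<open>g g'\<inverse>\<close> is mapped into \<open>L\<close> and so lies in \<open>A\<close>; hence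
  \<open>g\<close> and \<open>g'\<close> are both in \<open>A\<close> or both outside. In this way membership in \<open>A\<close> extends
  to an \<open>L\<close>-invariant subset of \<open>K\<close>.\<close>

lemma coset_complement:
  assumes L: "subgroup L K" and A: "subgroup A G" and LA: "\<And>g. g \<in> carrier G \<Longrightarrow> \<phi> g \<in> L \<Longrightarrow> g \<in> A"
    and g: "g \<in> carrier G"
  shows "\<phi> g \<in> L <#>\<^bsub>K\<^esub> \<phi> ` (carrier G - A) \<longleftrightarrow> g \<notin> A"
proof
  assume "\<phi> g \<in> L <#>\<^bsub>K\<^esub> \<phi> ` (carrier G - A)"
  then obtain l g' where l: "l \<in> L" "\<phi> g = l \<otimes>\<^bsub>K\<^esub> \<phi> g'" and g': "g' \<in> carrier G" "g' \<notin> A"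
    by (auto simp: set_mult_def)
  have "\<phi> (g \<otimes> inv g') = l"
    using l g g' subgroup.mem_carrier[OF L l(1)] by (simp add: H.m_assoc)
  then have *: "g \<otimes> inv g' \<in> A"
    using l(1) g g' LA by auto
  show "g \<notin> A"
  proof
    assume "g \<in> A"
    then have "inv (g \<otimes> inv g') \<otimes> g \<in> A"
      using * A by (simp add: subgroup.m_closed subgroup.m_inv_closed)
    then show False using g g' by (simp add: G.inv_mult_group G.m_assoc)
  qed
next
  assume "g \<notin> A"
  then have "\<one>\<^bsub>K\<^esub> \<otimes>\<^bsub>K\<^esub> \<phi> g \<in> L <#>\<^bsub>K\<^esub> \<phi> ` (carrier G - A)"
    using g subgroup.one_closed[OF L] unfolding set_mult_def by blast
  then show "\<phi> g \<in> L <#>\<^bsub>K\<^esub> \<phi> ` (carrier G - A)" using g by simp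
qed

lemma c_idem [simp]: "k \<in> carrier K \<Longrightarrow> c (c k) = c k"
  using c_mult[of "p k" "c k"] by (simp add: decomp)

lemma c_comp [simp]: "g \<in> carrier G \<Longrightarrow> k \<in> carrier K \<Longrightarrow> c (\<phi> g \<otimes>\<^bsub>K\<^esub> c k) = c k"
  by (simp add: c_mult)

end

lemma mon_transversal:
  assumes G: "group G" and K: "group K" and \<phi>: "\<phi> \<in> mon G K"
  obtains p c where "transversal G K \<phi> p c"
proof -
  interpret group_hom G K \<phi>
    using assms by (simp add: group_hom_def group_hom_axioms_def mon_def)
  have inj: "inj_on \<phi> (carrier G)" using \<phi> by (simp add: mon_def)
  define C where "C k = \<phi> ` carrier G #>\<^bsub>K\<^esub> k" for k
  interpret I: subgroup "\<phi> ` carrier G" K by (rule img_is_subgroup)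
  have C_mult: "C (\<phi> g \<otimes>\<^bsub>K\<^esub> k) = C k" if "g \<in> carrier G" "k \<in> carrier K" for g k
    unfolding C_def using that
    by (metis H.coset_mult_assoc H.coset_join2 I.subset I.subgroup_axioms hom_closed imageI)
  \<comment> \<open>\<open>c\<close> depends on the coset only, and the case distinction makes it pick the unit where it can.\<close>
  define c where "c k = (if \<one>\<^bsub>K\<^esub> \<in> C k then \<one>\<^bsub>K\<^esub> else SOME y. y \<in> C k)" for k
  have c_C: "c k \<in> C k" if "k \<in> carrier K" for k
  proof -
    have "k \<in> C k" unfolding C_def using that by (simp add: H.rcos_self I.subgroup_axioms)
    then show ?thesis by (auto simp: c_def intro: someI)
  qed
  have c_K: "c k \<in> carrier K" if "k \<in> carrier K" for k
    using c_C[OF that] that by (auto simp: C_def r_coset_def)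
  define p where "p k = inv_into (carrier G) \<phi> (k \<otimes>\<^bsub>K\<^esub> inv\<^bsub>K\<^esub> c k)" for k
  have ex: "k \<otimes>\<^bsub>K\<^esub> inv\<^bsub>K\<^esub> c k \<in> \<phi> ` carrier G" if k: "k \<in> carrier K" for k
  proof -
    obtain g where g: "g \<in> carrier G" "c k = \<phi> g \<otimes>\<^bsub>K\<^esub> k"
      using c_C[OF k] by (auto simp: C_def r_coset_def)
    then have "k \<otimes>\<^bsub>K\<^esub> inv\<^bsub>K\<^esub> c k = \<phi> (inv\<^bsub>G\<^esub> g)"
      using k by (simp add: H.inv_mult_group flip: H.m_assoc)
    then show ?thesis using g(1) by blast
  qed
  have p: "p k \<in> carrier G" "\<phi> (p k) = k \<otimes>\<^bsub>K\<^esub> inv\<^bsub>K\<^esub> c k" if "k \<in> carrier K" for k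
    using ex[OF that] by (auto simp: p_def inv_into_into f_inv_into_f)
  have c_mult: "c (\<phi> g \<otimes>\<^bsub>K\<^esub> k) = c k" if "g \<in> carrier G" "k \<in> carrier K" for g k
    using C_mult[OF that] by (simp add: c_def)
  have c_one: "c \<one>\<^bsub>K\<^esub> = \<one>\<^bsub>K\<^esub>"
    by (simp add: c_def C_def H.rcos_self I.subgroup_axioms)
  have "transversal G K \<phi> p c"
  proof
    fix g k assume gk: "g \<in> carrier G" "k \<in> carrier K"
    show "p (\<phi> g \<otimes>\<^bsub>K\<^esub> k) = g \<otimes>\<^bsub>G\<^esub> p k"
      by (rule inj_onD[OF inj]) (use gk in \<open>simp_all add: p c_mult c_K H.m_assoc\<close>)
  next
    show "p \<one>\<^bsub>K\<^esub> = \<one>\<^bsub>G\<^esub>"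
      by (rule inj_onD[OF inj]) (use p[of "\<one>\<^bsub>K\<^esub>"] in \<open>simp_all add: c_one\<close>)
  qed (simp_all add: p c_K c_mult H.m_assoc)
  then show thesis by (rule that)
qed

locale two_transversals =
  T1: transversal G K1 \<phi>1 p1 c1 + T2: transversal G K2 \<phi>2 p2 c2
  for G :: "('a, 'm) monoid_scheme" (structure)
    and K1 :: "('k, 'm1) monoid_scheme" and \<phi>1 p1 c1
    and K2 :: "('l, 'm2) monoid_scheme" and \<phi>2 p2 c2
begin

text \<open>The common set on which both groups act: the pairs with equal \<open>G\<close>-components, with two bits
  attached. An element of \<open>K1\<close> multiplies the first coordinate and then resets the \<open>G\<close>-component of the
  second one to match, and symmetrically for \<open>K2\<close>; an element of \<open>G\<close> therefore acts in both ways as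
  left multiplication on both coordinates.\<close>

definition points :: "('k \<times> 'l \<times> bool \<times> bool) set" where
  "points = {(x, y, a, b). x \<in> carrier K1 \<and> y \<in> carrier K2 \<and> p1 x = p2 y}"

definition act1 :: "'k \<Rightarrow> 'k \<times> 'l \<times> bool \<times> bool \<Rightarrow> 'k \<times> 'l \<times> bool \<times> bool" where
  "act1 k = (\<lambda>(x, y, s). (k \<otimes>\<^bsub>K1\<^esub> x, \<phi>2 (p1 (k \<otimes>\<^bsub>K1\<^esub> x)) \<otimes>\<^bsub>K2\<^esub> c2 y, s))"

definition act2 :: "'l \<Rightarrow> 'k \<times> 'l \<times> bool \<times> bool \<Rightarrow> 'k \<times> 'l \<times> bool \<times> bool" where
  "act2 k = (\<lambda>(x, y, s). (\<phi>1 (p2 (k \<otimes>\<^bsub>K2\<^esub> y)) \<otimes>\<^bsub>K1\<^esub> c1 x, k \<otimes>\<^bsub>K2\<^esub> y, s))"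

definition flip1 :: "'k set \<Rightarrow> 'k \<times> 'l \<times> bool \<times> bool \<Rightarrow> 'k \<times> 'l \<times> bool \<times> bool" where
  "flip1 P = (\<lambda>(x, y, a, b). (x, y, a \<noteq> (x \<in> P), b))"

definition flip2 :: "'l set \<Rightarrow> 'k \<times> 'l \<times> bool \<times> bool \<Rightarrow> 'k \<times> 'l \<times> bool \<times> bool" where
  "flip2 P = (\<lambda>(x, y, a, b). (x, y, a, b \<noteq> (y \<in> P)))"

text \<open>The points of the orbit of \<open>(\<one>, \<one>)\<close> under \<open>G\<close>, a copy of the regular action.\<close>

definition base_point :: "'a \<Rightarrow> bool \<Rightarrow> bool \<Rightarrow> 'k \<times> 'l \<times> bool \<times> bool" where
  "base_point g a b = (\<phi>1 g, \<phi>2 g, a, b)"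

lemma base_point_points [simp]: "g \<in> carrier G \<Longrightarrow> base_point g a b \<in> points"
  by (simp add: base_point_def points_def)

lemma base_point_eq_iff:
  "g \<in> carrier G \<Longrightarrow> g' \<in> carrier G \<Longrightarrow>
    base_point g a b = base_point g' a' b' \<longleftrightarrow> g = g' \<and> a = a' \<and> b = b'"
  using T1.inj_emb by (auto simp: base_point_def dest: inj_onD)

lemma p1_decomp: "x \<in> carrier K1 \<Longrightarrow> y \<in> carrier K2 \<Longrightarrow> p1 x = p2 y \<Longrightarrow> \<phi>1 (p2 y) \<otimes>\<^bsub>K1\<^esub> c1 x = x"
  using T1.decomp[of x] by simp

lemma act1_hom: "(\<lambda>k. restrict (act1 k) points) \<in> hom K1 (BijGroup points)"
  by (rule action_hom_BijGroup) 
    (auto simp: points_def act1_def T2.decomp T1.H.is_group T1.H.m_assoc)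

lemma act2_hom: "(\<lambda>k. restrict (act2 k) points) \<in> hom K2 (BijGroup points)"
  by (rule action_hom_BijGroup) 
    (auto simp: points_def act2_def p1_decomp T2.H.is_group T2.H.m_assoc)

lemma act1_emb:
  "g \<in> carrier G \<Longrightarrow> (x, y, s) \<in> points \<Longrightarrow> act1 (\<phi>1 g) (x, y, s) = (\<phi>1 g \<otimes>\<^bsub>K1\<^esub> x, \<phi>2 g \<otimes>\<^bsub>K2\<^esub> y, s)"
  using T2.decomp[of y] by (auto simp: points_def act1_def T1.p_mult T2.H.m_assoc)

lemma act2_emb:
  "g \<in> carrier G \<Longrightarrow> (x, y, s) \<in> points \<Longrightarrow> act2 (\<phi>2 g) (x, y, s) = (\<phi>1 g \<otimes>\<^bsub>K1\<^esub> x, \<phi>2 g \<otimes>\<^bsub>K2\<^esub> y, s)"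
  using T1.decomp[of x] by (auto simp: points_def act2_def T2.p_mult T1.H.m_assoc)

lemma flip1_BijGroup: "restrict (flip1 P) points \<in> carrier (BijGroup points)"
  by (rule BijGroup_memI[where g = "flip1 P"]) (auto simp: points_def flip1_def)

lemma flip2_BijGroup: "restrict (flip2 P) points \<in> carrier (BijGroup points)"
  by (rule BijGroup_memI[where g = "flip2 P"]) (auto simp: points_def flip2_def)

end

section \<open>The amalgam with two stable letters\<close>

text \<open>\<open>M\<close> stands for the amalgam of \<open>K1\<close> and \<open>K2\<close> along \<open>G\<close> with stable letters \<open>t1\<close> and
  \<open>t2\<close>. Of its universal property, only the existence of homomorphisms is assumed, and only into groups
  \<open>B\<close> of permutations of one type, that of the points with two bits: no type can be quantified
  over in an assumption.\<close>

locale stable_amalgam = two_transversals G K1 \<phi>1 p1 c1 K2 \<phi>2 p2 c2 +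
  S1: subgroup L1 K1 + S2: subgroup L2 K2 + M: group M +
  \<psi>1: group_hom K1 M \<psi>1 + \<psi>2: group_hom K2 M \<psi>2
  for G :: "('a, 'm) monoid_scheme" (structure)
    and K1 :: "('k, 'm1) monoid_scheme" and \<phi>1 p1 c1 L1
    and K2 :: "('l, 'm2) monoid_scheme" and \<phi>2 p2 c2 L2
    and M :: "('n, 'm3) monoid_scheme" and \<psi>1 \<psi>2 +
  fixes t1 t2
  assumes stable_closed [simp]: "t1 \<in> carrier M" "t2 \<in> carrier M"
    and amalgamated: "g \<in> carrier G \<Longrightarrow> \<psi>1 (\<phi>1 g) = \<psi>2 (\<phi>2 g)"
    and stable1: "l \<in> L1 \<Longrightarrow> t1 \<otimes>\<^bsub>M\<^esub> \<psi>1 l = \<psi>1 l \<otimes>\<^bsub>M\<^esub> t1"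
    and stable2: "l' \<in> L2 \<Longrightarrow> t2 \<otimes>\<^bsub>M\<^esub> \<psi>2 l' = \<psi>2 l' \<otimes>\<^bsub>M\<^esub> t2"
    and universal: "\<And>(B :: ('k \<times> 'l \<times> bool \<times> bool \<Rightarrow> 'k \<times> 'l \<times> bool \<times> bool) monoid) \<rho>1 \<rho>2 \<tau>1 \<tau>2.
      \<lbrakk>group B; \<rho>1 \<in> hom K1 B; \<rho>2 \<in> hom K2 B; \<tau>1 \<in> carrier B; \<tau>2 \<in> carrier B;
        \<And>g. g \<in> carrier G \<Longrightarrow> \<rho>1 (\<phi>1 g) = \<rho>2 (\<phi>2 g);
        \<And>l. l \<in> L1 \<Longrightarrow> \<tau>1 \<otimes>\<^bsub>B\<^esub> \<rho>1 l = \<rho>1 l \<otimes>\<^bsub>B\<^esub> \<tau>1;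
        \<And>l. l \<in> L2 \<Longrightarrow> \<tau>2 \<otimes>\<^bsub>B\<^esub> \<rho>2 l = \<rho>2 l \<otimes>\<^bsub>B\<^esub> \<tau>2\<rbrakk> \<Longrightarrow>
      \<exists>h \<in> hom M B. (\<forall>k \<in> carrier K1. h (\<psi>1 k) = \<rho>1 k) \<and> h t1 = \<tau>1 \<and> h t2 = \<tau>2"
begin

definition emb :: "'a \<Rightarrow> 'n" where
  "emb g = \<psi>1 (\<phi>1 g)"

sublocale emb: group_hom G M emb
proof
  show "emb \<in> hom G M"
    unfolding emb_def using hom_compose[OF T1.homh \<psi>1.homh] by (simp add: comp_def)
qed

definition H1 :: "'a set" where "H1 = {g \<in> carrier G. \<phi>1 g \<in> L1}"
definition H2 :: "'a set" where "H2 = {g \<in> carrier G. \<phi>2 g \<in> L2}"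

text \<open>The representation that replaces normal forms: on the \<open>G\<close>-orbit of the base point, \<open>G\<close> acts
  regularly, and the stable letters record in the two bits whether the point lies outside
  \<open>A1\<close> and outside \<open>A2\<close>. The containments \<open>H1 \<subseteq> A1\<close> and \<open>H2 \<subseteq> A2\<close> make these tests extend to
  permutations of all points that commute with \<open>L1\<close> and with \<open>L2\<close>.\<close>

lemma stable_action:
  assumes A1: "subgroup A1 G" "H1 \<subseteq> A1" and A2: "subgroup A2 G" "H2 \<subseteq> A2"
  obtains h where "h \<in> hom M (BijGroup points)"
    "\<And>g g' a b. g \<in> carrier G \<Longrightarrow> g' \<in> carrier G \<Longrightarrow> h (emb g) (base_point g' a b) = base_point (g \<otimes> g') a b"
    "\<And>g a b. g \<in> carrier G \<Longrightarrow> h t1 (base_point g a b) = base_point g (a \<noteq> (g \<notin> A1)) b"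
    "\<And>g a b. g \<in> carrier G \<Longrightarrow> h t2 (base_point g a b) = base_point g a (b \<noteq> (g \<notin> A2))"
proof -
  define P1 where "P1 = L1 <#>\<^bsub>K1\<^esub> \<phi>1 ` (carrier G - A1)"
  define P2 where "P2 = L2 <#>\<^bsub>K2\<^esub> \<phi>2 ` (carrier G - A2)"
  let ?B = "BijGroup points"
  let ?r = "\<lambda>f. restrict f points"
  have P1_inv: "l \<otimes>\<^bsub>K1\<^esub> x \<in> P1 \<longleftrightarrow> x \<in> P1" if "l \<in> L1" "x \<in> carrier K1" for l x
    unfolding P1_def
    by (rule T1.H.subgroup_set_mult_invariant) (use that S1.subgroup_axioms in auto)
  have P2_inv: "l \<otimes>\<^bsub>K2\<^esub> x \<in> P2 \<longleftrightarrow> x \<in> P2" if "l \<in> L2" "x \<in> carrier K2" for l x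
    unfolding P2_def
    by (rule T2.H.subgroup_set_mult_invariant) (use that S2.subgroup_axioms in auto)
  have closed1: "?r (act1 k) \<in> carrier ?B" if "k \<in> carrier K1" for k
    using act1_hom that by (auto simp: hom_def)
  have closed2: "?r (act2 k) \<in> carrier ?B" if "k \<in> carrier K2" for k
    using act2_hom that by (auto simp: hom_def)
  have "\<exists>h \<in> hom M ?B. (\<forall>k \<in> carrier K1. h (\<psi>1 k) = ?r (act1 k)) \<and>
      h t1 = ?r (flip1 P1) \<and> h t2 = ?r (flip2 P2)"
  proof (rule universal[OF group_BijGroup act1_hom act2_hom flip1_BijGroup flip2_BijGroup])
    fix g assume "g \<in> carrier G"
    then show "?r (act1 (\<phi>1 g)) = ?r (act2 (\<phi>2 g))"
      by (auto simp: fun_eq_iff restrict_def act1_emb act2_emb)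
  next
    fix l assume l: "l \<in> L1"
    then have lK: "l \<in> carrier K1" by simp
    show "?r (flip1 P1) \<otimes>\<^bsub>?B\<^esub> ?r (act1 l) = ?r (act1 l) \<otimes>\<^bsub>?B\<^esub> ?r (flip1 P1)"
      by (rule BijGroup_commuteI[OF flip1_BijGroup closed1[OF lK]])
        (use l in \<open>auto simp: points_def act1_def flip1_def P1_inv\<close>)
  next
    fix l assume l: "l \<in> L2"
    then have lK: "l \<in> carrier K2" by simp
    show "?r (flip2 P2) \<otimes>\<^bsub>?B\<^esub> ?r (act2 l) = ?r (act2 l) \<otimes>\<^bsub>?B\<^esub> ?r (flip2 P2)"
      by (rule BijGroup_commuteI[OF flip2_BijGroup closed2[OF lK]])
        (use l in \<open>auto simp: points_def act2_def flip2_def P2_inv\<close>)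
  qed
  then obtain h where h: "h \<in> hom M ?B" "\<And>k. k \<in> carrier K1 \<Longrightarrow> h (\<psi>1 k) = ?r (act1 k)"
    "h t1 = ?r (flip1 P1)" "h t2 = ?r (flip2 P2)" by blast
  show thesis
  proof (rule that[OF h(1)])
    fix g g' a b assume "g \<in> carrier G" "g' \<in> carrier G"
    then show "h (emb g) (base_point g' a b) = base_point (g \<otimes> g') a b"
      using base_point_points[of g' a b] by (simp add: emb_def h(2) act1_emb base_point_def)
  next
    fix g a b assume g: "g \<in> carrier G"
    then have "\<phi>1 g \<in> P1 \<longleftrightarrow> g \<notin> A1"
      unfolding P1_def
      by (intro T1.coset_complement S1.subgroup_axioms A1(1)) (use A1(2) in \<open>auto simp: H1_def\<close>)
    then show "h t1 (base_point g a b) = base_point g (a \<noteq> (g \<notin> A1)) b"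
      using base_point_points[of g a b] g by (simp add: h(3) flip1_def base_point_def)
  next
    fix g a b assume g: "g \<in> carrier G"
    then have "\<phi>2 g \<in> P2 \<longleftrightarrow> g \<notin> A2"
      unfolding P2_def
      by (intro T2.coset_complement S2.subgroup_axioms A2(1)) (use A2(2) in \<open>auto simp: H2_def\<close>)
    then show "h t2 (base_point g a b) = base_point g a (b \<noteq> (g \<notin> A2))"
      using base_point_points[of g a b] g by (simp add: h(4) flip2_def base_point_def)
  qed
qed

lemma subgroup_H1: "subgroup H1 G"
proof (rule T1.G.subgroupI)
  show "H1 \<noteq> {}" using S1.one_closed by (auto simp: H1_def intro!: exI[of _ \<one>])
qed (auto simp: H1_def)

lemma subgroup_H2: "subgroup H2 G"
proof (rule T1.G.subgroupI)
  show "H2 \<noteq> {}" using S2.one_closed by (auto simp: H2_def intro!: exI[of _ \<one>])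
qed (auto simp: H2_def)

lemma stable_commutes1: "g \<in> H1 \<Longrightarrow> t1 \<otimes>\<^bsub>M\<^esub> emb g = emb g \<otimes>\<^bsub>M\<^esub> t1"
  unfolding emb_def by (rule stable1) (simp add: H1_def)

lemma stable_commutes2: "g \<in> H2 \<Longrightarrow> t2 \<otimes>\<^bsub>M\<^esub> emb g = emb g \<otimes>\<^bsub>M\<^esub> t2"
  using stable2[of "\<phi>2 g"] amalgamated[of g] by (simp add: H2_def emb_def)

lemma hom_BijGroup_mult:
  "h \<in> hom M (BijGroup points) \<Longrightarrow> m \<in> carrier M \<Longrightarrow> m' \<in> carrier M \<Longrightarrow> x \<in> points \<Longrightarrow>
    h (m \<otimes>\<^bsub>M\<^esub> m') x = h m (h m' x)"
  by (auto simp: hom_def BijGroup_mult_apply Pi_iff)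

lemma inj_emb: "inj_on emb (carrier G)"
proof (rule inj_onI)
  fix g g' assume g: "g \<in> carrier G" "g' \<in> carrier G" "emb g = emb g'"
  obtain h where "h \<in> hom M (BijGroup points)"
    and h: "\<And>g g' a b. g \<in> carrier G \<Longrightarrow> g' \<in> carrier G \<Longrightarrow>
      h (emb g) (base_point g' a b) = base_point (g \<otimes> g') a b"
    by (rule stable_action[OF T1.G.subgroup_self subgroup.subset[OF subgroup_H1]
        T1.G.subgroup_self subgroup.subset[OF subgroup_H2]], rule that)
  have "base_point g False False = base_point g' False False"
    using h[of g \<one> False False] h[of g' \<one> False False] g by simp
  then show "g = g'" using g base_point_eq_iff by blast
qed

text \<open>If \<open>emb g w = w emb g'\<close>, apply both sides to the base point, in the representation whose bits test
  membership in \<open>H1\<close> and \<open>H2\<close>. The left side gives the point \<open>g\<close> with both bits off, as \<open>w\<close> fixes the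
  base point; the right side gives \<open>g'\<close> with the bits telling whether \<open>g'\<close> is
  outside \<open>H1\<close> and outside \<open>H2\<close>.\<close>

lemma emb_Int_conjugate:
  defines "w \<equiv> t1 \<otimes>\<^bsub>M\<^esub> t2"
  shows "emb ` carrier G \<inter> (\<lambda>g. w \<otimes>\<^bsub>M\<^esub> emb g \<otimes>\<^bsub>M\<^esub> inv\<^bsub>M\<^esub> w) ` carrier G = emb ` (H1 \<inter> H2)"
proof (intro equalityI subsetI)
  fix m assume "m \<in> emb ` carrier G \<inter> (\<lambda>g. w \<otimes>\<^bsub>M\<^esub> emb g \<otimes>\<^bsub>M\<^esub> inv\<^bsub>M\<^esub> w) ` carrier G"
  then obtain g g' where g: "g \<in> carrier G" "g' \<in> carrier G" "m = emb g"
    "emb g = w \<otimes>\<^bsub>M\<^esub> emb g' \<otimes>\<^bsub>M\<^esub> inv\<^bsub>M\<^esub> w" by auto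
  have w: "w \<in> carrier M" by (simp add: w_def)
  have *: "emb g \<otimes>\<^bsub>M\<^esub> w = w \<otimes>\<^bsub>M\<^esub> emb g'"
    using g w by (simp add: M.m_assoc)
  obtain h where h: "h \<in> hom M (BijGroup points)"
    and hg: "\<And>g g' a b. g \<in> carrier G \<Longrightarrow> g' \<in> carrier G \<Longrightarrow>
      h (emb g) (base_point g' a b) = base_point (g \<otimes> g') a b"
    and h1: "\<And>g a b. g \<in> carrier G \<Longrightarrow> h t1 (base_point g a b) = base_point g (a \<noteq> (g \<notin> H1)) b"
    and h2: "\<And>g a b. g \<in> carrier G \<Longrightarrow> h t2 (base_point g a b) = base_point g a (b \<noteq> (g \<notin> H2))"
    using stable_action[OF subgroup_H1 _ subgroup_H2] by blast
  have one: "\<one> \<in> H1" "\<one> \<in> H2"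
    using subgroup_H1 subgroup_H2 by (auto dest: subgroup.one_closed)
  let ?x = "base_point \<one> False False"
  have "h (emb g \<otimes>\<^bsub>M\<^esub> w) ?x = base_point g False False"
    using g(1) one w by (simp add: w_def hom_BijGroup_mult[OF h] hg h1 h2)
  moreover have "h (w \<otimes>\<^bsub>M\<^esub> emb g') ?x = base_point g' (g' \<notin> H1) (g' \<notin> H2)"
    using g(2) one w by (simp add: w_def hom_BijGroup_mult[OF h] hg h1 h2)
  ultimately have "base_point g False False = base_point g' (g' \<notin> H1) (g' \<notin> H2)"
    using * by simp
  then have "g = g' \<and> False = (g' \<notin> H1) \<and> False = (g' \<notin> H2)"
    unfolding base_point_eq_iff[OF g(1,2)] .
  then have "g = g' \<and> g' \<in> H1 \<and> g' \<in> H2" by simp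
  then show "m \<in> emb ` (H1 \<inter> H2)" using g(3) by blast
next
  fix m assume "m \<in> emb ` (H1 \<inter> H2)"
  then obtain g where g: "g \<in> H1" "g \<in> H2" "m = emb g" by blast
  have gG: "g \<in> carrier G" using g(1) by (simp add: H1_def)
  have "w \<otimes>\<^bsub>M\<^esub> emb g = t1 \<otimes>\<^bsub>M\<^esub> (t2 \<otimes>\<^bsub>M\<^esub> emb g)"
    using gG by (simp add: w_def M.m_assoc)
  also have "\<dots> = (t1 \<otimes>\<^bsub>M\<^esub> emb g) \<otimes>\<^bsub>M\<^esub> t2"
    using gG by (simp add: stable_commutes2[OF g(2)] M.m_assoc)
  also have "\<dots> = emb g \<otimes>\<^bsub>M\<^esub> w"
    using gG by (simp add: stable_commutes1[OF g(1)] w_def M.m_assoc)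
  finally have "m = w \<otimes>\<^bsub>M\<^esub> emb g \<otimes>\<^bsub>M\<^esub> inv\<^bsub>M\<^esub> w"
    using gG g(3) by (simp add: w_def M.m_assoc)
  then show "m \<in> emb ` carrier G \<inter> (\<lambda>g. w \<otimes>\<^bsub>M\<^esub> emb g \<otimes>\<^bsub>M\<^esub> inv\<^bsub>M\<^esub> w) ` carrier G"
    using gG g(3) by blast
qed

text \<open>In the representation in which both stable letters test membership in the join \<open>J\<close>, consider the
  set \<open>Y\<close> of orbit points whose two bits differ exactly if the point is outside \<open>J\<close>. Each stable
  letter exchanges \<open>Y\<close> with the \<open>G\<close>-invariant set of orbit points with equal bits, so the conjugates of
  \<open>G\<close> by the stable letters preserve \<open>Y\<close>, whereas an element \<open>g\<close> of \<open>G\<close> can map the base point into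
  \<open>Y\<close> only if \<open>g \<in> J\<close>.\<close>

lemma emb_Int_generate_conjugates:
  defines "S \<equiv> (\<lambda>g. t1 \<otimes>\<^bsub>M\<^esub> emb g \<otimes>\<^bsub>M\<^esub> inv\<^bsub>M\<^esub> t1) ` carrier G \<union>
    (\<lambda>g. t2 \<otimes>\<^bsub>M\<^esub> emb g \<otimes>\<^bsub>M\<^esub> inv\<^bsub>M\<^esub> t2) ` carrier G"
  shows "emb ` carrier G \<inter> generate M S = emb ` generate G (H1 \<union> H2)"
proof (intro equalityI subsetI)
  fix m assume "m \<in> emb ` carrier G \<inter> generate M S"
  then obtain g where g: "g \<in> carrier G" "m = emb g" and mS: "m \<in> generate M S" by blast
  define J where "J = generate G (H1 \<union> H2)"
  have sub: "H1 \<union> H2 \<subseteq> carrier G" by (auto simp: H1_def H2_def)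
  have J: "subgroup J G" unfolding J_def by (rule T1.G.generate_is_subgroup[OF sub])
  have HJ: "H1 \<subseteq> J" "H2 \<subseteq> J" by (auto simp: J_def intro: generate.incl)
  obtain h where h: "h \<in> hom M (BijGroup points)"
    and hg: "\<And>g g' a b. g \<in> carrier G \<Longrightarrow> g' \<in> carrier G \<Longrightarrow>
      h (emb g) (base_point g' a b) = base_point (g \<otimes> g') a b"
    and h1: "\<And>g a b. g \<in> carrier G \<Longrightarrow> h t1 (base_point g a b) = base_point g (a \<noteq> (g \<notin> J)) b"
    and h2: "\<And>g a b. g \<in> carrier G \<Longrightarrow> h t2 (base_point g a b) = base_point g a (b \<noteq> (g \<notin> J))"
    using stable_action[OF J HJ(1) J HJ(2)] by blast
  define Y where "Y = {base_point g a b | g a b. g \<in> carrier G \<and> (a \<noteq> b \<longleftrightarrow> g \<notin> J)}"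
  have Y_pts: "Y \<subseteq> points" by (auto simp: Y_def)
  have conj_Y: "h (t \<otimes>\<^bsub>M\<^esub> emb k \<otimes>\<^bsub>M\<^esub> inv\<^bsub>M\<^esub> t) x \<in> Y"
    if t: "t = t1 \<or> t = t2" and k: "k \<in> carrier G" and x: "x \<in> Y" for t k x
  proof -
    have tM: "t \<in> carrier M" using t by auto
    obtain g' a b where g': "g' \<in> carrier G" "a \<noteq> b \<longleftrightarrow> g' \<notin> J" "x = base_point g' a b"
      using x by (auto simp: Y_def)
    \<comment> \<open>Each stable letter is an involution on the orbit, so \<open>x\<close> comes from a point with equal bits.\<close>
    obtain c where z: "x = h t (base_point g' c c)"
    proof -
      have "x = h t1 (base_point g' b b)" "x = h t2 (base_point g' a a)"
        unfolding g'(3) h1[OF g'(1)] h2[OF g'(1)] using g'(2) by (cases "g' \<in> J"; simp)+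
      then show thesis using t that by blast
    qed
    have "h (t \<otimes>\<^bsub>M\<^esub> emb k \<otimes>\<^bsub>M\<^esub> inv\<^bsub>M\<^esub> t) x =
        h (t \<otimes>\<^bsub>M\<^esub> emb k \<otimes>\<^bsub>M\<^esub> inv\<^bsub>M\<^esub> t \<otimes>\<^bsub>M\<^esub> t) (base_point g' c c)"
      unfolding z using tM k g' by (simp add: hom_BijGroup_mult[OF h])
    also have "\<dots> = h (t \<otimes>\<^bsub>M\<^esub> emb k) (base_point g' c c)"
      using tM k by (simp add: M.m_assoc)
    also have "\<dots> = h t (base_point (k \<otimes> g') c c)"
      using tM k g' by (simp add: hom_BijGroup_mult[OF h] hg)
    also have "\<dots> \<in> Y"
      using t k g'(1) h1[of "k \<otimes> g'" c c] h2[of "k \<otimes> g'" c c] unfolding Y_def by blast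
    finally show ?thesis .
  qed
  have S_M: "S \<subseteq> carrier M" by (auto simp: S_def)
  have inv_S: "inv\<^bsub>M\<^esub> s \<in> S" if "s \<in> S" for s
  proof -
    obtain t k where s: "t = t1 \<or> t = t2" "k \<in> carrier G" "s = t \<otimes>\<^bsub>M\<^esub> emb k \<otimes>\<^bsub>M\<^esub> inv\<^bsub>M\<^esub> t"
      using \<open>s \<in> S\<close> by (auto simp: S_def)
    then have inv_s: "inv\<^bsub>M\<^esub> s = t \<otimes>\<^bsub>M\<^esub> emb (inv k) \<otimes>\<^bsub>M\<^esub> inv\<^bsub>M\<^esub> t"
      by (auto simp: M.inv_mult_group M.m_assoc)
    have "inv k \<in> carrier G" using s(2) by simp
    then show ?thesis using s(1) unfolding inv_s S_def by blast
  qed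
  have S_Y: "h s x \<in> Y" if "s \<in> S" "x \<in> Y" for s x
    using that(1) conj_Y[OF _ _ that(2)] unfolding S_def by blast
  have "h m x \<in> Y" if "x \<in> Y" for x
    using mS that
  proof (induction arbitrary: x rule: generate.induct)
    case one
    obtain g' a b where g': "g' \<in> carrier G" "x = base_point g' a b"
      using one unfolding Y_def by blast
    have "h \<one>\<^bsub>M\<^esub> x = x" using hg[of \<one> g' a b] g' by simp
    then show ?case using one by simp
  next
    case (inv s)
    then show ?case using S_Y inv_S by blast
  next
    case (eng m m')
    have "m \<in> carrier M" "m' \<in> carrier M"
      using eng.hyps M.generate_incl[OF S_M] by auto
    moreover have "x \<in> points" using eng.prems Y_pts by blast
    ultimately show ?case using eng by (simp add: hom_BijGroup_mult[OF h])
  qed (rule S_Y)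
  moreover have "\<one> \<in> J" using J by (rule subgroup.one_closed)
  then have "base_point \<one> False False \<in> Y" unfolding Y_def by blast
  ultimately have "h (emb g) (base_point \<one> False False) \<in> Y" using g(2) by simp
  then have "base_point g False False \<in> Y"
    using g(1) by (simp add: hg)
  then have "\<exists>g' a b. base_point g False False = base_point g' a b \<and> g' \<in> carrier G \<and>
      (a \<noteq> b \<longleftrightarrow> g' \<notin> J)"
    unfolding Y_def by (rule CollectD)
  then obtain g' a b where g': "base_point g False False = base_point g' a b" "g' \<in> carrier G"
    and ab: "a \<noteq> b \<longleftrightarrow> g' \<notin> J"
    by (elim exE conjE) (rule that)
  have "g = g' \<and> False = a \<and> False = b"
    using g'(1) unfolding base_point_eq_iff[OF g(1) g'(2)] .
  with ab have "g \<in> J" by simp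
  then show "m \<in> emb ` generate G (H1 \<union> H2)" using g(2) by (simp add: J_def)
next
  have S_M: "S \<subseteq> carrier M" by (auto simp: S_def)
  have sub: "H1 \<union> H2 \<subseteq> carrier G" by (auto simp: H1_def H2_def)
  have mem: "emb g \<in> S" if "g \<in> H1 \<union> H2" for g
  proof -
    have "\<exists>t\<in>{t1, t2}. t \<otimes>\<^bsub>M\<^esub> emb g = emb g \<otimes>\<^bsub>M\<^esub> t"
      using that stable_commutes1[of g] stable_commutes2[of g] by auto
    then obtain t where t: "t \<in> {t1, t2}" "t \<otimes>\<^bsub>M\<^esub> emb g = emb g \<otimes>\<^bsub>M\<^esub> t" by (rule bexE)
    have g: "g \<in> carrier G" using that sub by blast
    have tM: "t \<in> carrier M" using t(1) by auto
    have "emb g = t \<otimes>\<^bsub>M\<^esub> emb g \<otimes>\<^bsub>M\<^esub> inv\<^bsub>M\<^esub> t"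
      using tM g by (simp add: t(2) M.m_assoc)
    then show ?thesis using t(1) g by (auto simp: S_def)
  qed
  fix m assume m: "m \<in> emb ` generate G (H1 \<union> H2)"
  have "emb ` generate G (H1 \<union> H2) = generate M (emb ` (H1 \<union> H2))"
    by (rule emb.generate_img[OF sub, symmetric])
  also have "\<dots> \<subseteq> generate M S"
    using mem by (intro M.mono_generate) auto
  finally have "m \<in> generate M S" using m by blast
  moreover have "m \<in> emb ` carrier G" using m T1.G.generate_incl[OF sub] by blast
  ultimately show "m \<in> emb ` carrier G \<inter> generate M S" by blast
qed

end

section \<open>The combined presentation presents the amalgam\<close>

lemma hom_eq_on_generate:
  assumes h: "group_hom G H h" and k: "group_hom G H k" and S: "S \<subseteq> carrier G"
    and eq: "\<And>s. s \<in> S \<Longrightarrow> h s = k s" and x: "x \<in> generate G S"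
  shows "h x = k x"
proof -
  interpret h: group_hom G H h by fact
  interpret k: group_hom G H k by fact
  from x show ?thesis
  proof (induction rule: generate.induct)
    case (inv s)
    then show ?case using S eq by (metis h.hom_inv k.hom_inv subsetD)
  next
    case (eng x y)
    then have "x \<in> carrier G" "y \<in> carrier G" using h.G.generate_incl[OF S] by auto
    with eng show ?case by simp
  qed (simp_all add: eq)
qed

text \<open>The homomorphism \<open>h\<close> and its conjugate by \<open>t\<close> agree on the generators.\<close>

lemma hom_commute_on_generate:
  assumes h: "group_hom G H h" and t: "t \<in> carrier H" and S: "S \<subseteq> carrier G"
    and comm: "\<And>s. s \<in> S \<Longrightarrow> t \<otimes>\<^bsub>H\<^esub> h s = h s \<otimes>\<^bsub>H\<^esub> t" and x: "x \<in> generate G S"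
  shows "t \<otimes>\<^bsub>H\<^esub> h x = h x \<otimes>\<^bsub>H\<^esub> t"
proof -
  interpret h: group_hom G H h by fact
  have conj: "group_hom G H (\<lambda>x. t \<otimes>\<^bsub>H\<^esub> h x \<otimes>\<^bsub>H\<^esub> inv\<^bsub>H\<^esub> t)"
    by unfold_locales (auto simp: hom_def h.H.m_assoc t h.H.inv_solve_left)
  have xG: "x \<in> carrier G" using h.G.generate_incl[OF S] x by blast
  have "t \<otimes>\<^bsub>H\<^esub> h x \<otimes>\<^bsub>H\<^esub> inv\<^bsub>H\<^esub> t = h x"
  proof (rule hom_eq_on_generate[OF conj h S _ x])
    fix s assume "s \<in> S"
    then show "t \<otimes>\<^bsub>H\<^esub> h s \<otimes>\<^bsub>H\<^esub> inv\<^bsub>H\<^esub> t = h s"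
      using comm S t by (simp add: h.H.m_assoc subset_iff)
  qed
  then show ?thesis
    using t xG h.H.inv_solve_right' by (metis h.H.inv_closed h.H.m_closed h.hom_closed)
qed

locale data_pair =
  fixes d1 d2 :: overgroup_data
  assumes wf1: "set (data_rels d1) \<union> set (data_emb d1) \<union> set (data_sub d1) \<subseteq> words {..<data_gens d1}"
    and wf2: "set (data_rels d2) \<union> set (data_emb d2) \<union> set (data_sub d2) \<subseteq> words {..<data_gens d2}"
begin

abbreviation "n1 \<equiv> data_gens d1"
abbreviation "n2 \<equiv> data_gens d2"
abbreviation "gens \<equiv> {..<Suc (Suc (n1 + n2))}"
abbreviation "rels \<equiv> set (amalgam_rels d1 d2)"
abbreviation "M \<equiv> presented_group gens rels"
abbreviation "rep \<equiv> word_elem gens rels"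
abbreviation "gen x \<equiv> rep [(x, True)]"

lemma words1 [simp]: "w \<in> words {..<n1} \<Longrightarrow> w \<in> words gens"
  by (erule words_mono) auto

lemma words2 [simp]: "w \<in> words {..<n2} \<Longrightarrow> shift_word n1 w \<in> words gens"
  by (erule shift_word_words) simp

lemma rels_words: "rels \<subseteq> words gens"
proof -
  have "set (data_rels d1) \<subseteq> words {..<n1}" "set (data_emb d1) \<subseteq> words {..<n1}"
    "set (data_sub d1) \<subseteq> words {..<n1}" "set (data_rels d2) \<subseteq> words {..<n2}"
    "set (data_emb d2) \<subseteq> words {..<n2}" "set (data_sub d2) \<subseteq> words {..<n2}"
    using wf1 wf2 by auto
  then show ?thesis
    by (auto simp: amalgam_rels_def stable_letter_1_def stable_letter_2_def subset_iff
        elim!: in_set_zipE)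
qed

sublocale M: group M
  by (rule group_presented_group[OF rels_words])

sublocale K1: group "data_group d1"
  unfolding data_group_def by (rule group_presented_group) (use wf1 in auto)

sublocale K2: group "data_group d2"
  unfolding data_group_def by (rule group_presented_group) (use wf2 in auto)

lemma rep_closed [simp]: "w \<in> words gens \<Longrightarrow> rep w \<in> carrier M"
  by (simp add: carrier_presented_group)

lemma gen_closed: "gen \<in> gens \<rightarrow> carrier M"
  by auto

lemma rep_value: "w \<in> words gens \<Longrightarrow> rep w = word_value M gen w"
  by (rule word_elem_eq_word_value[OF rels_words])

lemma rep_append: "u \<in> words gens \<Longrightarrow> v \<in> words gens \<Longrightarrow> rep (u @ v) = rep u \<otimes>\<^bsub>M\<^esub> rep v"
  by (rule mult_word_elem[OF rels_words, symmetric])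

lemma rep_inverse: "w \<in> words gens \<Longrightarrow> rep (inverse_word w) = inv\<^bsub>M\<^esub> rep w"
  by (simp add: rep_value M.word_value_inverse[OF gen_closed])

lemma rep_conjugate:
  "u \<in> words gens \<Longrightarrow> w \<in> words gens \<Longrightarrow>
    rep (conjugate_word u w) = rep u \<otimes>\<^bsub>M\<^esub> rep w \<otimes>\<^bsub>M\<^esub> inv\<^bsub>M\<^esub> rep u"
  by (simp add: rep_value M.word_value_conjugate[OF gen_closed])

lemma rep_rel: "r \<in> rels \<Longrightarrow> rep r = \<one>\<^bsub>M\<^esub>"
  by (rule word_elem_relator[OF rels_words])

lemma rep_emb_eq:
  assumes "j < length (data_emb d1)" "j < length (data_emb d2)"
  shows "rep (data_emb d1 ! j) = rep (shift_word n1 (data_emb d2 ! j))"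
proof -
  let ?u = "data_emb d1 ! j" and ?v = "shift_word n1 (data_emb d2 ! j)"
  have uv: "?u \<in> words gens" "?v \<in> words gens"
    using assms wf1 wf2 by (auto simp: subset_iff)
  have "(data_emb d1 ! j, data_emb d2 ! j) \<in> set (zip (data_emb d1) (data_emb d2))"
    using assms by (auto simp: set_zip)
  then have "?u @ inverse_word ?v \<in> rels"
    by (auto simp: amalgam_rels_def intro!: image_eqI)
  then have "rep ?u \<otimes>\<^bsub>M\<^esub> inv\<^bsub>M\<^esub> rep ?v = \<one>\<^bsub>M\<^esub>"
    using rep_rel[of "?u @ inverse_word ?v"] uv by (simp add: rep_append rep_inverse)
  then show ?thesis
    using uv M.inv_solve_right' by (metis M.l_one M.one_closed rep_closed)
qed

lemma rep_commute:
  assumes "conjugate_word [(x, True)] w @ inverse_word w \<in> rels" "x \<in> gens" "w \<in> words gens"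
  shows "gen x \<otimes>\<^bsub>M\<^esub> rep w = rep w \<otimes>\<^bsub>M\<^esub> gen x"
proof -
  have "gen x \<otimes>\<^bsub>M\<^esub> rep w \<otimes>\<^bsub>M\<^esub> inv\<^bsub>M\<^esub> gen x \<otimes>\<^bsub>M\<^esub> inv\<^bsub>M\<^esub> rep w = \<one>\<^bsub>M\<^esub>"
    using rep_rel[OF assms(1)] assms(2,3) by (simp add: rep_append rep_conjugate rep_inverse)
  then show ?thesis
    using assms(2,3) by (simp add: M.inv_solve_right')
qed

lemma rep_stable1: "w \<in> set (data_sub d1) \<Longrightarrow> gen (n1 + n2) \<otimes>\<^bsub>M\<^esub> rep w = rep w \<otimes>\<^bsub>M\<^esub> gen (n1 + n2)"
  by (rule rep_commute) (use wf1 in \<open>auto simp: amalgam_rels_def stable_letter_1_def\<close>)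

lemma rep_stable2:
  "w \<in> set (data_sub d2) \<Longrightarrow>
    gen (Suc (n1 + n2)) \<otimes>\<^bsub>M\<^esub> rep (shift_word n1 w) = rep (shift_word n1 w) \<otimes>\<^bsub>M\<^esub> gen (Suc (n1 + n2))"
  by (rule rep_commute) (use wf2 in \<open>auto simp: amalgam_rels_def stable_letter_2_def\<close>)

lemma inclusion1:
  obtains \<psi> where "\<psi> \<in> hom (data_group d1) M"
    "\<And>w. w \<in> words {..<n1} \<Longrightarrow> \<psi> (data_elem d1 w) = rep w"
proof -
  have f: "gen \<in> {..<n1} \<rightarrow> carrier M" by auto
  have rels: "set (data_rels d1) \<subseteq> words {..<n1}" using wf1 by auto
  have "word_value M gen r = \<one>\<^bsub>M\<^esub>" if "r \<in> set (data_rels d1)" for r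
  proof -
    have "r \<in> rels" using that by (simp add: amalgam_rels_def)
    then show ?thesis using rep_rel[of r] rep_value[of r] rels_words by auto
  qed
  from presented_group_universal[OF M.is_group rels f this]
  obtain \<psi> where "\<psi> \<in> hom (data_group d1) M"
    "\<And>w. w \<in> words {..<n1} \<Longrightarrow> \<psi> (data_elem d1 w) = word_value M gen w"
    unfolding data_group_def data_elem_def by blast
  then show thesis by (intro that[of \<psi>]) (simp_all add: rep_value)
qed

lemma inclusion2:
  obtains \<psi> where "\<psi> \<in> hom (data_group d2) M"
    "\<And>w. w \<in> words {..<n2} \<Longrightarrow> \<psi> (data_elem d2 w) = rep (shift_word n1 w)"
proof -
  have f: "(\<lambda>x. gen (n1 + x)) \<in> {..<n2} \<rightarrow> carrier M" by auto
  have rels: "set (data_rels d2) \<subseteq> words {..<n2}" using wf2 by auto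
  have "word_value M (\<lambda>x. gen (n1 + x)) r = \<one>\<^bsub>M\<^esub>" if "r \<in> set (data_rels d2)" for r
  proof -
    have "shift_word n1 r \<in> rels" using that by (simp add: amalgam_rels_def)
    then show ?thesis
      using rep_rel[of "shift_word n1 r"] rep_value[of "shift_word n1 r"] rels_words
      by (auto simp: word_value_shift)
  qed
  from presented_group_universal[OF M.is_group rels f this]
  obtain \<psi> where "\<psi> \<in> hom (data_group d2) M"
    "\<And>w. w \<in> words {..<n2} \<Longrightarrow> \<psi> (data_elem d2 w) = word_value M (\<lambda>x. gen (n1 + x)) w"
    unfolding data_group_def data_elem_def by blast
  then show thesis by (intro that[of \<psi>]) (simp_all add: rep_value word_value_shift)
qed

text \<open>Evaluate words by sending each block of generators to the matching images; the hypotheses are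
  what the five kinds of relators demand, and von Dyck's theorem applies.\<close>

lemma amalgam_universal:
  assumes B: "group B" and \<rho>1: "\<rho>1 \<in> hom (data_group d1) B" and \<rho>2: "\<rho>2 \<in> hom (data_group d2) B"
    and \<tau>: "\<tau>1 \<in> carrier B" "\<tau>2 \<in> carrier B"
    and emb: "\<And>u v. (u, v) \<in> set (zip (data_emb d1) (data_emb d2)) \<Longrightarrow>
      \<rho>1 (data_elem d1 u) = \<rho>2 (data_elem d2 v)"
    and comm1: "\<And>w. w \<in> set (data_sub d1) \<Longrightarrow>
      \<tau>1 \<otimes>\<^bsub>B\<^esub> \<rho>1 (data_elem d1 w) = \<rho>1 (data_elem d1 w) \<otimes>\<^bsub>B\<^esub> \<tau>1"
    and comm2: "\<And>w. w \<in> set (data_sub d2) \<Longrightarrow>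
      \<tau>2 \<otimes>\<^bsub>B\<^esub> \<rho>2 (data_elem d2 w) = \<rho>2 (data_elem d2 w) \<otimes>\<^bsub>B\<^esub> \<tau>2"
  obtains h where "h \<in> hom M B"
    "\<And>w. w \<in> words {..<n1} \<Longrightarrow> h (rep w) = \<rho>1 (data_elem d1 w)"
    "h (gen (n1 + n2)) = \<tau>1" "h (gen (Suc (n1 + n2))) = \<tau>2"
proof -
  interpret B: group B by fact
  interpret \<rho>1: group_hom "data_group d1" B \<rho>1 by unfold_locales fact
  interpret \<rho>2: group_hom "data_group d2" B \<rho>2 by unfold_locales fact
  define f where "f x = (if x < n1 then \<rho>1 (data_elem d1 [(x, True)])
    else if x < n1 + n2 then \<rho>2 (data_elem d2 [(x - n1, True)])
    else if x = n1 + n2 then \<tau>1 else \<tau>2)" for x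
  have rels1: "set (data_rels d1) \<subseteq> words {..<n1}" and rels2: "set (data_rels d2) \<subseteq> words {..<n2}"
    using wf1 wf2 by auto
  have closed1: "data_elem d1 w \<in> carrier (data_group d1)" if "w \<in> words {..<n1}" for w
    using that by (simp add: data_elem_def data_group_def carrier_presented_group)
  have closed2: "data_elem d2 w \<in> carrier (data_group d2)" if "w \<in> words {..<n2}" for w
    using that by (simp add: data_elem_def data_group_def carrier_presented_group)
  have f: "f \<in> gens \<rightarrow> carrier B"
    using \<tau> by (auto simp: f_def closed1 closed2)
  have val1: "word_value B f w = \<rho>1 (data_elem d1 w)" if w: "w \<in> words {..<n1}" for w
  proof -
    have "\<rho>1 (data_elem d1 w) = \<rho>1 (word_value (data_group d1) (\<lambda>x. data_elem d1 [(x, True)]) w)"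
      using word_elem_eq_word_value[OF rels1 w] by (simp add: data_elem_def data_group_def)
    also have "\<dots> = word_value B (\<lambda>x. \<rho>1 (data_elem d1 [(x, True)])) w"
      by (rule \<rho>1.hom_word_value[OF _ w]) (auto simp: closed1)
    also have "\<dots> = word_value B f w"
      by (rule word_value_cong[OF _ w]) (simp add: f_def)
    finally show ?thesis ..
  qed
  have val2: "word_value B f (shift_word n1 w) = \<rho>2 (data_elem d2 w)" if w: "w \<in> words {..<n2}" for w
  proof -
    have "\<rho>2 (data_elem d2 w) = \<rho>2 (word_value (data_group d2) (\<lambda>x. data_elem d2 [(x, True)]) w)"
      using word_elem_eq_word_value[OF rels2 w] by (simp add: data_elem_def data_group_def)
    also have "\<dots> = word_value B (\<lambda>x. \<rho>2 (data_elem d2 [(x, True)])) w"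
      by (rule \<rho>2.hom_word_value[OF _ w]) (auto simp: closed2)
    also have "\<dots> = word_value B (\<lambda>x. f (n1 + x)) w"
      by (rule word_value_cong[OF _ w]) (simp add: f_def)
    finally show ?thesis by (simp add: word_value_shift)
  qed
  have comm_rel: "word_value B f (conjugate_word [(x, True)] w @ inverse_word w) = \<one>\<^bsub>B\<^esub>"
    if "x \<in> gens" "w \<in> words gens" "f x \<otimes>\<^bsub>B\<^esub> word_value B f w = word_value B f w \<otimes>\<^bsub>B\<^esub> f x" for x w
  proof -
    have "f x \<in> carrier B" "word_value B f w \<in> carrier B" using f that by auto
    with that show ?thesis
      by (simp add: B.word_value_append[OF f] B.word_value_conjugate[OF f] B.word_value_inverse[OF f] B.m_assoc)
  qed
  have "word_value B f r = \<one>\<^bsub>B\<^esub>" if r: "r \<in> rels" for r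
  proof -
    consider (rel1) "r \<in> set (data_rels d1)"
      | (rel2) r' where "r' \<in> set (data_rels d2)" "r = shift_word n1 r'"
      | (emb) u v where "(u, v) \<in> set (zip (data_emb d1) (data_emb d2))"
          "r = u @ inverse_word (shift_word n1 v)"
      | (sub1) w where "w \<in> set (data_sub d1)"
          "r = conjugate_word [(n1 + n2, True)] w @ inverse_word w"
      | (sub2) w where "w \<in> set (data_sub d2)"
          "r = conjugate_word [(Suc (n1 + n2), True)] (shift_word n1 w) @ inverse_word (shift_word n1 w)"
      using r by (auto simp: amalgam_rels_def stable_letter_1_def stable_letter_2_def)
    then show ?thesis
    proof cases
      case rel1
      then have "data_elem d1 r = \<one>\<^bsub>data_group d1\<^esub>"
        using word_elem_relator[OF rels1] by (simp add: data_elem_def data_group_def)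
      then show ?thesis using val1[of r] rel1 rels1 by (simp add: subset_iff)
    next
      case rel2
      then have "data_elem d2 r' = \<one>\<^bsub>data_group d2\<^esub>"
        using word_elem_relator[OF rels2] by (simp add: data_elem_def data_group_def)
      then show ?thesis using val2[of r'] rel2 rels2 by (simp add: subset_iff)
    next
      case emb
      then have uv: "u \<in> words {..<n1}" "v \<in> words {..<n2}"
        using wf1 wf2 by (auto dest: set_zip_leftD set_zip_rightD)
      then show ?thesis
        using emb(1) assms(6)[of u v]
        by (simp add: emb(2) B.word_value_append[OF f] B.word_value_inverse[OF f] val1 val2 closed2)
    next
      case sub1
      then have "w \<in> words {..<n1}" using wf1 by auto
      then show ?thesis
        unfolding sub1(2) by (intro comm_rel) (use comm1[OF sub1(1)] in \<open>auto simp: val1 f_def\<close>)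
    next
      case sub2
      then have "w \<in> words {..<n2}" using wf2 by auto
      then show ?thesis
        unfolding sub2(2) by (intro comm_rel) (use comm2[OF sub2(1)] in \<open>auto simp: val2 f_def\<close>)
    qed
  qed
  from presented_group_universal[OF B rels_words f this]
  obtain h where h: "h \<in> hom M B" "\<And>w. w \<in> words gens \<Longrightarrow> h (rep w) = word_value B f w" by blast
  show thesis
    by (rule that[OF h(1)]) (auto simp: h(2) val1 val2 f_def \<tau>)
qed

end

locale overgroup_pair = data_pair d1 d2 + G: group G
  for G :: "('a, 'b) monoid_scheme" and gs :: "'a list" and A1 A2 d1 d2 +
  assumes gs: "set gs \<subseteq> carrier G" "generate G (set gs) = carrier G"
    and benign1: "explicitly_benign G gs A1 d1" and benign2: "explicitly_benign G gs A2 d2"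
begin

lemma length_emb: "length (data_emb d1) = length gs" "length (data_emb d2) = length gs"
  using benign1 benign2 by (auto simp: explicitly_benign_def)

text \<open>The transversals and the two inclusions put the presented group into the situation of the abstract
  amalgam, whose intersection formulas are restated here for the concrete stable letters.\<close>

lemma embedding:
  obtains e where "e \<in> mon G M"
    "\<And>j. j < length gs \<Longrightarrow> e (gs ! j) = rep (data_emb d1 ! j)"
    "let w = gen (n1 + n2) \<otimes>\<^bsub>M\<^esub> gen (Suc (n1 + n2)) in
      e ` carrier G \<inter> (\<lambda>g. w \<otimes>\<^bsub>M\<^esub> e g \<otimes>\<^bsub>M\<^esub> inv\<^bsub>M\<^esub> w) ` carrier G = e ` (A1 \<inter> A2)"
    "e ` carrier G \<inter> generate M
        ((\<lambda>g. gen (n1 + n2) \<otimes>\<^bsub>M\<^esub> e g \<otimes>\<^bsub>M\<^esub> inv\<^bsub>M\<^esub> gen (n1 + n2)) ` carrier G \<union>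
         (\<lambda>g. gen (Suc (n1 + n2)) \<otimes>\<^bsub>M\<^esub> e g \<otimes>\<^bsub>M\<^esub> inv\<^bsub>M\<^esub> gen (Suc (n1 + n2))) ` carrier G) =
      e ` generate G (A1 \<union> A2)"
proof -
  obtain \<phi>1 where via1: "benign_via G A1 (data_group d1) \<phi>1 (data_subgroup d1)"
    and \<phi>1: "\<And>j. j < length gs \<Longrightarrow> \<phi>1 (gs ! j) = data_elem d1 (data_emb d1 ! j)"
    using benign1 by (auto simp: explicitly_benign_def)
  obtain \<phi>2 where via2: "benign_via G A2 (data_group d2) \<phi>2 (data_subgroup d2)"
    and \<phi>2: "\<And>j. j < length gs \<Longrightarrow> \<phi>2 (gs ! j) = data_elem d2 (data_emb d2 ! j)"
    using benign2 by (auto simp: explicitly_benign_def)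
  have sub: "subgroup A1 G" "subgroup A2 G"
    using benign1 benign2 by (auto simp: explicitly_benign_def)
  obtain p1 c1 where T1: "transversal G (data_group d1) \<phi>1 p1 c1"
    by (rule mon_transversal[OF G.is_group K1.is_group]) (use via1 in \<open>auto simp: benign_via_def\<close>)
  obtain p2 c2 where T2: "transversal G (data_group d2) \<phi>2 p2 c2"
    by (rule mon_transversal[OF G.is_group K2.is_group]) (use via2 in \<open>auto simp: benign_via_def\<close>)
  interpret T1: transversal G "data_group d1" \<phi>1 p1 c1 by fact
  interpret T2: transversal G "data_group d2" \<phi>2 p2 c2 by fact
  obtain \<psi>1 where \<psi>1: "\<psi>1 \<in> hom (data_group d1) M"
    "\<And>w. w \<in> words {..<n1} \<Longrightarrow> \<psi>1 (data_elem d1 w) = rep w"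
    using inclusion1 by blast
  obtain \<psi>2 where \<psi>2: "\<psi>2 \<in> hom (data_group d2) M"
    "\<And>w. w \<in> words {..<n2} \<Longrightarrow> \<psi>2 (data_elem d2 w) = rep (shift_word n1 w)"
    using inclusion2 by blast
  interpret \<psi>1: group_hom "data_group d1" M \<psi>1 by unfold_locales fact
  interpret \<psi>2: group_hom "data_group d2" M \<psi>2 by unfold_locales fact
  have emb_words: "data_emb d1 ! j \<in> words {..<n1}" "data_emb d2 ! j \<in> words {..<n2}"
    if "j < length gs" for j
    using that wf1 wf2 length_emb by (auto simp: subset_iff)
  have sub_elems1: "data_elem d1 ` set (data_sub d1) \<subseteq> carrier (data_group d1)"
    and sub_elems2: "data_elem d2 ` set (data_sub d2) \<subseteq> carrier (data_group d2)"
    using wf1 wf2 by (auto simp: data_elem_def data_group_def carrier_presented_group)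
  have hom_comp: "group_hom G M (\<lambda>g. \<psi>1 (\<phi>1 g))" "group_hom G M (\<lambda>g. \<psi>2 (\<phi>2 g))"
    using hom_compose[OF T1.homh \<psi>1(1)] hom_compose[OF T2.homh \<psi>2(1)]
    by (auto simp: group_hom_def group_hom_axioms_def comp_def G.is_group M.is_group)
  have L1_eq: "data_subgroup d1 = generate (data_group d1) (data_elem d1 ` set (data_sub d1))"
    and L2_eq: "data_subgroup d2 = generate (data_group d2) (data_elem d2 ` set (data_sub d2))"
    by (simp_all add: data_subgroup_def)
  interpret S: stable_amalgam G "data_group d1" \<phi>1 p1 c1 "data_subgroup d1"
    "data_group d2" \<phi>2 p2 c2 "data_subgroup d2" M \<psi>1 \<psi>2 "gen (n1 + n2)" "gen (Suc (n1 + n2))"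
  proof (intro stable_amalgam.intro stable_amalgam_axioms.intro two_transversals.intro T1 T2)
    show "subgroup (data_subgroup d1) (data_group d1)" "subgroup (data_subgroup d2) (data_group d2)"
      using via1 via2 by (simp_all add: benign_via_def)
    show "group M" by (rule M.is_group)
    show "group_hom (data_group d1) M \<psi>1" "group_hom (data_group d2) M \<psi>2"
      by (rule \<psi>1.group_hom_axioms \<psi>2.group_hom_axioms)+
    show "gen (n1 + n2) \<in> carrier M" "gen (Suc (n1 + n2)) \<in> carrier M" by simp_all
  next
    fix g assume g: "g \<in> carrier G"
    show "\<psi>1 (\<phi>1 g) = \<psi>2 (\<phi>2 g)"
    proof (rule hom_eq_on_generate[OF hom_comp gs(1)])
      show "g \<in> generate G (set gs)" using g gs(2) by simp
      fix x assume "x \<in> set gs"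
      then obtain j where j: "j < length gs" "x = gs ! j" by (auto simp: in_set_conv_nth)
      then show "\<psi>1 (\<phi>1 x) = \<psi>2 (\<phi>2 x)"
        using rep_emb_eq[of j] length_emb emb_words[OF j(1)] by (simp add: \<phi>1 \<phi>2 \<psi>1(2) \<psi>2(2))
    qed
  next
    fix l assume l: "l \<in> data_subgroup d1"
    show "gen (n1 + n2) \<otimes>\<^bsub>M\<^esub> \<psi>1 l = \<psi>1 l \<otimes>\<^bsub>M\<^esub> gen (n1 + n2)"
    proof (rule hom_commute_on_generate[OF \<psi>1.group_hom_axioms _ sub_elems1 _ l[unfolded L1_eq]])
      fix s assume "s \<in> data_elem d1 ` set (data_sub d1)"
      then obtain w where "w \<in> set (data_sub d1)" "s = data_elem d1 w" by blast
      then show "gen (n1 + n2) \<otimes>\<^bsub>M\<^esub> \<psi>1 s = \<psi>1 s \<otimes>\<^bsub>M\<^esub> gen (n1 + n2)"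
        using rep_stable1[of w] wf1 by (simp add: \<psi>1(2) subset_iff)
    qed simp
  next
    fix l assume l: "l \<in> data_subgroup d2"
    show "gen (Suc (n1 + n2)) \<otimes>\<^bsub>M\<^esub> \<psi>2 l = \<psi>2 l \<otimes>\<^bsub>M\<^esub> gen (Suc (n1 + n2))"
    proof (rule hom_commute_on_generate[OF \<psi>2.group_hom_axioms _ sub_elems2 _ l[unfolded L2_eq]])
      fix s assume "s \<in> data_elem d2 ` set (data_sub d2)"
      then obtain w where "w \<in> set (data_sub d2)" "s = data_elem d2 w" by blast
      then show "gen (Suc (n1 + n2)) \<otimes>\<^bsub>M\<^esub> \<psi>2 s = \<psi>2 s \<otimes>\<^bsub>M\<^esub> gen (Suc (n1 + n2))"
        using rep_stable2[of w] wf2 by (simp add: \<psi>2(2) subset_iff)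
    qed simp
  next
    fix B :: "(fp_elem \<times> fp_elem \<times> bool \<times> bool \<Rightarrow> fp_elem \<times> fp_elem \<times> bool \<times> bool) monoid"
      and \<rho>1 \<rho>2 \<tau>1 \<tau>2
    assume B: "group B" "\<rho>1 \<in> hom (data_group d1) B" "\<rho>2 \<in> hom (data_group d2) B"
      "\<tau>1 \<in> carrier B" "\<tau>2 \<in> carrier B"
      and eq: "\<And>g. g \<in> carrier G \<Longrightarrow> \<rho>1 (\<phi>1 g) = \<rho>2 (\<phi>2 g)"
      and comm1: "\<And>l. l \<in> data_subgroup d1 \<Longrightarrow> \<tau>1 \<otimes>\<^bsub>B\<^esub> \<rho>1 l = \<rho>1 l \<otimes>\<^bsub>B\<^esub> \<tau>1"
      and comm2: "\<And>l. l \<in> data_subgroup d2 \<Longrightarrow> \<tau>2 \<otimes>\<^bsub>B\<^esub> \<rho>2 l = \<rho>2 l \<otimes>\<^bsub>B\<^esub> \<tau>2"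
    obtain h where h: "h \<in> hom M B"
      "\<And>w. w \<in> words {..<n1} \<Longrightarrow> h (rep w) = \<rho>1 (data_elem d1 w)"
      "h (gen (n1 + n2)) = \<tau>1" "h (gen (Suc (n1 + n2))) = \<tau>2"
    proof (rule amalgam_universal[OF B])
      fix u v assume "(u, v) \<in> set (zip (data_emb d1) (data_emb d2))"
      then obtain j where j: "j < length gs" "u = data_emb d1 ! j" "v = data_emb d2 ! j"
        using length_emb by (auto simp: set_zip)
      then show "\<rho>1 (data_elem d1 u) = \<rho>2 (data_elem d2 v)"
        using eq[of "gs ! j"] gs(1) by (simp add: \<phi>1 \<phi>2 subset_iff)
    next
      fix w assume "w \<in> set (data_sub d1)"
      then show "\<tau>1 \<otimes>\<^bsub>B\<^esub> \<rho>1 (data_elem d1 w) = \<rho>1 (data_elem d1 w) \<otimes>\<^bsub>B\<^esub> \<tau>1"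
        by (intro comm1) (auto simp: L1_eq intro: generate.incl)
    next
      fix w assume "w \<in> set (data_sub d2)"
      then show "\<tau>2 \<otimes>\<^bsub>B\<^esub> \<rho>2 (data_elem d2 w) = \<rho>2 (data_elem d2 w) \<otimes>\<^bsub>B\<^esub> \<tau>2"
        by (intro comm2) (auto simp: L2_eq intro: generate.incl)
    qed (rule that)
    have "h (\<psi>1 k) = \<rho>1 k" if k: "k \<in> carrier (data_group d1)" for k
    proof -
      obtain w where "w \<in> words {..<n1}" "k = data_elem d1 w"
        using k by (auto simp: data_group_def data_elem_def carrier_presented_group)
      then show ?thesis by (simp add: \<psi>1(2) h(2))
    qed
    then show "\<exists>h\<in>hom M B. (\<forall>k\<in>carrier (data_group d1). h (\<psi>1 k) = \<rho>1 k) \<and>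
        h (gen (n1 + n2)) = \<tau>1 \<and> h (gen (Suc (n1 + n2))) = \<tau>2"
      using h(1,3,4) by blast
  qed
  \<comment> \<open>The hypothesis \<open>\<phi> G \<inter> L = \<phi> A\<close>, pulled back along the injection \<open>\<phi>\<close>.\<close>
  have preimage: "{g \<in> carrier G. \<phi> g \<in> L} = A"
    if via: "benign_via G A K \<phi> L" and A: "subgroup A G"
    for A and K :: "fp_elem monoid" and \<phi> L
  proof -
    have inj: "inj_on \<phi> (carrier G)" and Int: "\<phi> ` carrier G \<inter> L = \<phi> ` A"
      using via by (auto simp: benign_via_def mon_def)
    have "\<phi> g \<in> L \<longleftrightarrow> g \<in> A" if g: "g \<in> carrier G" for g
    proof -
      have "\<phi> g \<in> L \<longleftrightarrow> \<phi> g \<in> \<phi> ` A" using g unfolding Int[symmetric] by simp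
      then show ?thesis using inj_on_image_mem_iff[OF inj g subgroup.subset[OF A]] by simp
    qed
    then show ?thesis using subgroup.subset[OF A] by auto
  qed
  have H: "S.H1 = A1" "S.H2 = A2"
    unfolding S.H1_def S.H2_def using preimage[OF via1 sub(1)] preimage[OF via2 sub(2)] by simp_all
  show thesis
  proof (rule that[of S.emb])
    show "S.emb \<in> mon G M" using S.emb.homh S.inj_emb by (simp add: mon_def)
    show "S.emb (gs ! j) = rep (data_emb d1 ! j)" if "j < length gs" for j
      using that by (simp add: S.emb_def \<phi>1 \<psi>1(2) emb_words)
  qed (use S.emb_Int_conjugate S.emb_Int_generate_conjugates in \<open>simp_all add: H Let_def\<close>)
qed

text \<open>What remains to be checked for any choice \<open>ws\<close> of words generating the new subgroup is the
  intersection formula; presentation and embedding do not depend on \<open>ws\<close>.\<close>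

lemma explicitly_benign_amalgam:
  assumes e: "e \<in> mon G M" and e_gs: "\<And>j. j < length gs \<Longrightarrow> e (gs ! j) = rep (data_emb d1 ! j)"
    and H: "subgroup H G" and ws: "set ws \<subseteq> words gens"
    and Int: "e ` carrier G \<inter> generate M (rep ` set ws) = e ` H"
  shows "explicitly_benign G gs H (amalgam_data d1 d2 ws)"
proof -
  let ?d = "amalgam_data d1 d2 ws"
  have d: "data_group ?d = M" "data_elem ?d = rep" "data_subgroup ?d = generate M (rep ` set ws)"
    by (simp_all add: data_group_def data_elem_def data_subgroup_def amalgam_data_def)
  have ws_M: "rep ` set ws \<subseteq> carrier M" using ws by auto
  have L: "subgroup (generate M (rep ` set ws)) M" by (rule M.generate_is_subgroup[OF ws_M])
  have "rep ` set ws \<subseteq> generate M (rep ` set ws)" by (auto intro: generate.incl)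
  then have "finitely_generated (M\<lparr>carrier := generate M (rep ` set ws)\<rparr>)"
    unfolding finitely_generated_subgroup_iff[OF M.is_group L] by blast
  moreover have "finitely_presented M"
    unfolding finitely_presented_def using M.is_group rels_words iso_refl by blast
  ultimately have "benign_via G H M e (generate M (rep ` set ws))"
    using e L Int by (simp add: benign_via_def M.is_group)
  moreover have "set (data_rels ?d) \<union> set (data_emb ?d) \<union> set (data_sub ?d) \<subseteq> words {..<data_gens ?d}"
    using rels_words ws wf1 by (auto simp: amalgam_data_def)
  ultimately show ?thesis
    using H e_gs length_emb unfolding explicitly_benign_def d
    by (auto simp: amalgam_data_def)
qed

text \<open>The conjugates of the generators of \<open>G\<close> generate the conjugate of \<open>G\<close>, so the finitely many words
  chosen describe the subgroups in the intersection formulas.\<close>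

lemma explicitly_benign_intersection_join:
  shows explicitly_benign_intersection: "explicitly_benign G gs (A1 \<inter> A2) (intersection_data d1 d2)"
    and explicitly_benign_join: "explicitly_benign G gs (generate G (A1 \<union> A2)) (join_data d1 d2)"
proof -
  define t1 where "t1 = gen (n1 + n2)"
  define t2 where "t2 = gen (Suc (n1 + n2))"
  have t: "t1 \<in> carrier M" "t2 \<in> carrier M" by (simp_all add: t1_def t2_def)
  have sub: "subgroup A1 G" "subgroup A2 G"
    using benign1 benign2 by (auto simp: explicitly_benign_def)
  obtain e where e: "e \<in> mon G M"
    and e_gs: "\<And>j. j < length gs \<Longrightarrow> e (gs ! j) = rep (data_emb d1 ! j)"
    and inter: "e ` carrier G \<inter> (\<lambda>g. (t1 \<otimes>\<^bsub>M\<^esub> t2) \<otimes>\<^bsub>M\<^esub> e g \<otimes>\<^bsub>M\<^esub> inv\<^bsub>M\<^esub> (t1 \<otimes>\<^bsub>M\<^esub> t2)) ` carrier G =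
      e ` (A1 \<inter> A2)"
    and join: "e ` carrier G \<inter> generate M ((\<lambda>g. t1 \<otimes>\<^bsub>M\<^esub> e g \<otimes>\<^bsub>M\<^esub> inv\<^bsub>M\<^esub> t1) ` carrier G \<union>
         (\<lambda>g. t2 \<otimes>\<^bsub>M\<^esub> e g \<otimes>\<^bsub>M\<^esub> inv\<^bsub>M\<^esub> t2) ` carrier G) = e ` generate G (A1 \<union> A2)"
    by (rule embedding) (simp add: t1_def t2_def Let_def)
  interpret e: group_hom G M e
    using e by unfold_locales (simp add: mon_def)
  have emb_words: "set (data_emb d1) \<subseteq> words gens" using wf1 by auto
  have rep_emb: "rep ` set (data_emb d1) = e ` set gs"
    using e_gs length_emb(1) by (force simp: in_set_conv_nth image_iff)
  have conj_words: "rep ` set (map (conjugate_word u) (data_emb d1)) =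
      (\<lambda>g. rep u \<otimes>\<^bsub>M\<^esub> e g \<otimes>\<^bsub>M\<^esub> inv\<^bsub>M\<^esub> rep u) ` set gs" if u: "u \<in> words gens" for u
  proof -
    have "rep ` set (map (conjugate_word u) (data_emb d1)) =
        (\<lambda>m. rep u \<otimes>\<^bsub>M\<^esub> m \<otimes>\<^bsub>M\<^esub> inv\<^bsub>M\<^esub> rep u) ` rep ` set (data_emb d1)"
      using emb_words u by (auto simp: image_image rep_conjugate subset_iff intro!: image_cong)
    then show ?thesis by (simp add: rep_emb image_image)
  qed
  have conj_gen: "generate M ((\<lambda>g. t \<otimes>\<^bsub>M\<^esub> e g \<otimes>\<^bsub>M\<^esub> inv\<^bsub>M\<^esub> t) ` set gs) =
      (\<lambda>g. t \<otimes>\<^bsub>M\<^esub> e g \<otimes>\<^bsub>M\<^esub> inv\<^bsub>M\<^esub> t) ` carrier G" if t: "t \<in> carrier M" for t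
  proof -
    interpret c: group_hom G M "\<lambda>g. t \<otimes>\<^bsub>M\<^esub> e g \<otimes>\<^bsub>M\<^esub> inv\<^bsub>M\<^esub> t"
      by unfold_locales (auto simp: hom_def M.m_assoc t M.inv_solve_left)
    show ?thesis using c.generate_img[OF gs(1)] gs(2) by simp
  qed
  show "explicitly_benign G gs (A1 \<inter> A2) (intersection_data d1 d2)"
    unfolding intersection_data_def
  proof (rule explicitly_benign_amalgam[OF e e_gs])
    let ?u = "[stable_letter_1 d1 d2, stable_letter_2 d1 d2]"
    have u: "?u \<in> words gens" by (simp add: stable_letter_1_def stable_letter_2_def)
    have "rep ?u = t1 \<otimes>\<^bsub>M\<^esub> t2"
      using rep_append[of "[stable_letter_1 d1 d2]" "[stable_letter_2 d1 d2]"]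
      by (simp add: stable_letter_1_def stable_letter_2_def t1_def t2_def)
    then show "e ` carrier G \<inter> generate M (rep ` set (map (conjugate_word ?u) (data_emb d1))) =
        e ` (A1 \<inter> A2)"
      using conj_words[OF u] conj_gen[of "t1 \<otimes>\<^bsub>M\<^esub> t2"] t inter by simp
    show "set (map (conjugate_word ?u) (data_emb d1)) \<subseteq> words gens"
      using u emb_words by auto
    show "subgroup (A1 \<inter> A2) G" using sub by (rule G.subgroups_Inter_pair)
  qed
  show "explicitly_benign G gs (generate G (A1 \<union> A2)) (join_data d1 d2)"
    unfolding join_data_def
  proof (rule explicitly_benign_amalgam[OF e e_gs])
    let ?u1 = "[stable_letter_1 d1 d2]" and ?u2 = "[stable_letter_2 d1 d2]"
    let ?c = "\<lambda>t g. t \<otimes>\<^bsub>M\<^esub> e g \<otimes>\<^bsub>M\<^esub> inv\<^bsub>M\<^esub> t"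
    have u: "?u1 \<in> words gens" "?u2 \<in> words gens"
      by (simp_all add: stable_letter_1_def stable_letter_2_def)
    have "rep ?u1 = t1" "rep ?u2 = t2"
      by (simp_all add: stable_letter_1_def stable_letter_2_def t1_def t2_def)
    then have "rep ` set (map (conjugate_word ?u1) (data_emb d1) @
        map (conjugate_word ?u2) (data_emb d1)) = ?c t1 ` set gs \<union> ?c t2 ` set gs"
      using conj_words[OF u(1)] conj_words[OF u(2)] by (simp add: image_Un)
    moreover have "generate M (?c t1 ` set gs \<union> ?c t2 ` set gs) =
        generate M (?c t1 ` carrier G \<union> ?c t2 ` carrier G)"
    proof
      have closed: "?c t1 ` set gs \<union> ?c t2 ` set gs \<subseteq> carrier M"
        using gs(1) t by auto
      show "generate M (?c t1 ` set gs \<union> ?c t2 ` set gs) \<subseteq>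
          generate M (?c t1 ` carrier G \<union> ?c t2 ` carrier G)"
        using gs(1) by (intro M.mono_generate) auto
      show "generate M (?c t1 ` carrier G \<union> ?c t2 ` carrier G) \<subseteq>
          generate M (?c t1 ` set gs \<union> ?c t2 ` set gs)"
      proof (rule M.generate_subgroup_incl[OF _ M.generate_is_subgroup[OF closed]])
        show "?c t1 ` carrier G \<union> ?c t2 ` carrier G \<subseteq>
            generate M (?c t1 ` set gs \<union> ?c t2 ` set gs)"
          unfolding conj_gen[OF t(1), symmetric] conj_gen[OF t(2), symmetric]
          by (intro Un_least M.mono_generate) auto
      qed
    qed
    ultimately show "e ` carrier G \<inter> generate M (rep ` set (map (conjugate_word ?u1) (data_emb d1) @
        map (conjugate_word ?u2) (data_emb d1))) = e ` generate G (A1 \<union> A2)"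
      using join by simp
    show "set (map (conjugate_word ?u1) (data_emb d1) @ map (conjugate_word ?u2) (data_emb d1)) \<subseteq>
        words gens"
      using u emb_words by auto
    show "subgroup (generate G (A1 \<union> A2)) G"
      using sub by (intro G.generate_is_subgroup) (auto dest: subgroup.subset)
  qed
qed

end

section \<open>Finite families of benign subgroups\<close>

text \<open>Transport the overgroup to a presented group and choose words for the images of \<open>gs\<close> and for a
  finite generating set of the subgroup.\<close>

lemma benign_imp_explicitly_benign:
  assumes gs: "set gs \<subseteq> carrier G" and H: "benign G H"
  obtains d where "explicitly_benign G gs H d"
proof -
  obtain K :: "fp_elem monoid" and \<phi> L where via: "benign_via G H K \<phi> L" and sub: "subgroup H G"
    using H by (auto simp: benign_def)
  then have fp: "finitely_presented K" by (simp add: benign_via_def)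
  obtain n :: nat and R h where R: "finite R" "R \<subseteq> words {..<n}" and h: "h \<in> iso K (presented_group {..<n} R)"
    using fp unfolding finitely_presented_def is_iso_def by blast
  let ?P = "presented_group {..<n} R"
  have P: "group ?P" by (rule group_presented_group[OF R(2)])
  have via': "benign_via G H ?P (h \<circ> \<phi>) (h ` L)" by (rule benign_via_iso[OF via h P])
  then have L: "subgroup (h ` L) ?P" by (simp add: benign_via_def)
  obtain S where S: "finite S" "S \<subseteq> h ` L" "generate ?P S = h ` L"
    using via' finitely_generated_subgroup_iff[OF P L] by (auto simp: benign_via_def)
  define c where "c x = (SOME w. w \<in> words {..<n} \<and> word_elem {..<n} R w = x)" for x
  have c: "c x \<in> words {..<n}" "word_elem {..<n} R (c x) = x" if "x \<in> carrier ?P" for x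
  proof -
    have "\<exists>w. w \<in> words {..<n} \<and> word_elem {..<n} R w = x"
      using that by (auto simp: carrier_presented_group)
    then have "c x \<in> words {..<n} \<and> word_elem {..<n} R (c x) = x"
      unfolding c_def by (rule someI_ex)
    then show "c x \<in> words {..<n}" "word_elem {..<n} R (c x) = x" by auto
  qed
  obtain rs where rs: "set rs = R" using R(1) finite_list by blast
  obtain ss where ss: "set ss = S" using S(1) finite_list by blast
  have S_P: "S \<subseteq> carrier ?P" using S(2) subgroup.subset[OF L] by blast
  have im: "h (\<phi> g) \<in> carrier ?P" if "g \<in> carrier G" for g
    using via' that by (auto simp: benign_via_def mon_def hom_def)
  define d where "d = Overgroup_Data n rs (map (\<lambda>g. c (h (\<phi> g))) gs) (map c ss)"
  have "word_elem {..<n} R ` c ` S = S"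
    using S_P c(2) by (force simp: image_image subset_iff)
  then have d: "data_group d = ?P" "data_subgroup d = h ` L" "data_elem d = word_elem {..<n} R"
    using S(3) by (simp_all add: d_def data_group_def data_subgroup_def data_elem_def rs ss)
  have "explicitly_benign G gs H d"
    unfolding explicitly_benign_def
  proof (intro conjI exI[of _ "h \<circ> \<phi>"] sub)
    show "set (data_rels d) \<union> set (data_emb d) \<union> set (data_sub d) \<subseteq> words {..<data_gens d}"
      using R(2) rs ss S_P gs c(1) im by (auto simp: d_def subset_iff)
    show "length (data_emb d) = length gs" by (simp add: d_def)
    show "benign_via G H (data_group d) (h \<circ> \<phi>) (data_subgroup d)" using via' by (simp add: d)
    show "\<forall>j<length gs. (h \<circ> \<phi>) (gs ! j) = data_elem d (data_emb d ! j)"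
      unfolding d(3) using c(2) im gs by (simp add: d_def subset_iff)
  qed
  then show thesis by (rule that)
qed

lemma fold_data_snoc: "ds \<noteq> [] \<Longrightarrow> fold_data F (ds @ [d]) = F (fold_data F ds) d"
  by (cases ds) (simp_all add: fold_data_def)

lemma explicitly_benign_fold:
  assumes step: "\<And>H1 H2 d1 d2. explicitly_benign G gs H1 d1 \<Longrightarrow> explicitly_benign G gs H2 d2 \<Longrightarrow>
      explicitly_benign G gs (f H1 H2) (F d1 d2)"
    and A: "\<And>i. i \<in> {1..r} \<Longrightarrow> explicitly_benign G gs (A i) (d i)"
    and r: "1 \<le> r" and S1: "S 1 = A 1" and S_Suc: "\<And>k. 1 \<le> k \<Longrightarrow> k < r \<Longrightarrow> S (Suc k) = f (S k) (A (Suc k))"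
  shows "explicitly_benign G gs (S r) (fold_data F (map d [1..<Suc r]))"
proof -
  have "explicitly_benign G gs (S k) (fold_data F (map d [1..<Suc k]))" if "1 \<le> k" "k \<le> r" for k
    using that
  proof (induction k rule: dec_induct)
    case base
    then show ?case using A[of 1] r S1 by (simp add: fold_data_def)
  next
    case (step k)
    have "explicitly_benign G gs (f (S k) (A (Suc k))) (F (fold_data F (map d [1..<Suc k])) (d (Suc k)))"
      using step assms(1) A[of "Suc k"] by simp
    moreover have "map d [1..<Suc (Suc k)] = map d [1..<Suc k] @ [d (Suc k)]" by simp
    ultimately show ?case
      using step S_Suc[of k] fold_data_snoc[of "map d [1..<Suc k]" F "d (Suc k)"] by simp
  qed
  then show ?thesis using r by simp
qed

lemma explicitly_benign_Inter_Join:
  assumes G: "group G" and gs: "set gs \<subseteq> carrier G" "generate G (set gs) = carrier G"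
    and r: "1 \<le> r" and A: "\<And>i. i \<in> {1..r} \<Longrightarrow> explicitly_benign G gs (A i) (d i)"
  shows explicitly_benign_Inter:
      "explicitly_benign G gs (\<Inter>i\<in>{1..r}. A i) (fold_data intersection_data (map d [1..<Suc r]))"
    and explicitly_benign_Join:
      "explicitly_benign G gs (generate G (\<Union>i\<in>{1..r}. A i)) (fold_data join_data (map d [1..<Suc r]))"
proof -
  interpret group G by fact
  have pair: "overgroup_pair G gs H1 H2 d1 d2"
    if "explicitly_benign G gs H1 d1" "explicitly_benign G gs H2 d2" for H1 H2 d1 d2
    using that gs G
    by (simp add: overgroup_pair_def overgroup_pair_axioms_def data_pair_def explicitly_benign_def)
  have A_sub: "subgroup (A i) G" if "i \<in> {1..r}" for i
    using A[OF that] by (simp add: explicitly_benign_def)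
  have Suc_interval: "{1..Suc k} = insert (Suc k) {1..k}" if "1 \<le> k" for k
    using that by auto
  show "explicitly_benign G gs (\<Inter>i\<in>{1..r}. A i) (fold_data intersection_data (map d [1..<Suc r]))"
  proof (rule explicitly_benign_fold[where f = "(\<inter>)" and A = A and S = "\<lambda>r. \<Inter>i\<in>{1..r}. A i"])
    show "explicitly_benign G gs (H1 \<inter> H2) (intersection_data d1 d2)"
      if "explicitly_benign G gs H1 d1" "explicitly_benign G gs H2 d2" for H1 H2 d1 d2
      by (rule overgroup_pair.explicitly_benign_intersection[OF pair[OF that]])
    show "(\<Inter>i\<in>{1..Suc k}. A i) = (\<Inter>i\<in>{1..k}. A i) \<inter> A (Suc k)" if "1 \<le> k" for k
      unfolding Suc_interval[OF that] by auto
  qed (use A r in simp_all)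
  show "explicitly_benign G gs (generate G (\<Union>i\<in>{1..r}. A i)) (fold_data join_data (map d [1..<Suc r]))"
  proof (rule explicitly_benign_fold[where f = "\<lambda>H1 H2. generate G (H1 \<union> H2)" and A = A
        and S = "\<lambda>r. generate G (\<Union>i\<in>{1..r}. A i)"])
    show "explicitly_benign G gs (generate G (H1 \<union> H2)) (join_data d1 d2)"
      if "explicitly_benign G gs H1 d1" "explicitly_benign G gs H2 d2" for H1 H2 d1 d2
      by (rule overgroup_pair.explicitly_benign_join[OF pair[OF that]])
    show "generate G (\<Union>i\<in>{1..1}. A i) = A 1"
      using generateI[OF A_sub[of 1], of "A 1"] r by simp
    show "generate G (\<Union>i\<in>{1..Suc k}. A i) = generate G (generate G (\<Union>i\<in>{1..k}. A i) \<union> A (Suc k))"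
      if k: "1 \<le> k" "k < r" for k
    proof -
      let ?U = "\<Union>i\<in>{1..k}. A i"
      have U: "?U \<subseteq> carrier G" "A (Suc k) \<subseteq> carrier G"
        using k by (auto dest!: subgroup.subset[OF A_sub, THEN subsetD, rotated])
      have gU: "generate G ?U \<union> A (Suc k) \<subseteq> carrier G"
        using generate_incl[OF U(1)] U(2) by blast
      have "generate G (?U \<union> A (Suc k)) = generate G (generate G ?U \<union> A (Suc k))"
      proof
        show "generate G (?U \<union> A (Suc k)) \<subseteq> generate G (generate G ?U \<union> A (Suc k))"
          by (rule mono_generate) (auto intro: generate.incl)
        have "generate G ?U \<subseteq> generate G (?U \<union> A (Suc k))"
          by (rule mono_generate) simp
        then show "generate G (generate G ?U \<union> A (Suc k)) \<subseteq> generate G (?U \<union> A (Suc k))"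
          using U by (intro generate_subgroup_incl generate_is_subgroup) (auto intro: generate.incl)
      qed
      then show ?thesis unfolding Suc_interval[OF k(1)] by (simp add: Un_commute)
    qed
  qed (use A r in simp_all)
qed

theorem corollary4p5:
  shows
    "(\<forall>(G :: 'a monoid) (r :: nat) (A :: nat \<Rightarrow> 'a set).
        group G \<and> finitely_generated G \<and> 1 \<le> r \<and> (\<forall>i\<in>{1..r}. benign G (A i)) \<longrightarrow>
          benign G (\<Inter>i\<in>{1..r}. A i) \<and>
          benign G (generate G (\<Union>i\<in>{1..r}. A i))) \<and>
     (\<exists>F_I F_J :: overgroup_data list \<Rightarrow> overgroup_data.
        computable F_I \<and> computable F_J \<and>
        (\<forall>(G :: 'a monoid) (gs :: 'a list) (r :: nat) (A :: nat \<Rightarrow> 'a set)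
            (d :: nat \<Rightarrow> overgroup_data).
          group G \<and> set gs \<subseteq> carrier G \<and> generate G (set gs) = carrier G \<and> 1 \<le> r \<and>
          (\<forall>i\<in>{1..r}. explicitly_benign G gs (A i) (d i)) \<longrightarrow>
            explicitly_benign G gs (\<Inter>i\<in>{1..r}. A i) (F_I (map d [1..<Suc r])) \<and>
            explicitly_benign G gs (generate G (\<Union>i\<in>{1..r}. A i)) (F_J (map d [1..<Suc r]))))"
proof (rule conjI)
  show "\<forall>(G :: 'a monoid) (r :: nat) (A :: nat \<Rightarrow> 'a set).
      group G \<and> finitely_generated G \<and> 1 \<le> r \<and> (\<forall>i\<in>{1..r}. benign G (A i)) \<longrightarrow>
        benign G (\<Inter>i\<in>{1..r}. A i) \<and> benign G (generate G (\<Union>i\<in>{1..r}. A i))"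
  proof (intro allI impI, elim conjE)
    fix G :: "'a monoid" and r :: nat and A :: "nat \<Rightarrow> 'a set"
    assume G: "group G" and fg: "finitely_generated G" and r: "1 \<le> r"
      and A: "\<forall>i\<in>{1..r}. benign G (A i)"
    obtain gs where gs: "set gs \<subseteq> carrier G" "generate G (set gs) = carrier G"
      using fg finite_list unfolding finitely_generated_def by metis
    have "\<exists>d. explicitly_benign G gs (A i) d" if "i \<in> {1..r}" for i
      using benign_imp_explicitly_benign[OF gs(1)] A that by blast
    then obtain d where d: "\<And>i. i \<in> {1..r} \<Longrightarrow> explicitly_benign G gs (A i) (d i)" by metis
    show "benign G (\<Inter>i\<in>{1..r}. A i) \<and> benign G (generate G (\<Union>i\<in>{1..r}. A i))"
    proof
      show "benign G (\<Inter>i\<in>{1..r}. A i)"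
        by (rule explicitly_benign_imp_benign, rule explicitly_benign_Inter[OF G gs r], rule d)
      show "benign G (generate G (\<Union>i\<in>{1..r}. A i))"
        by (rule explicitly_benign_imp_benign, rule explicitly_benign_Join[OF G gs r], rule d)
    qed
  qed
next
  show "\<exists>F_I F_J :: overgroup_data list \<Rightarrow> overgroup_data.
      computable F_I \<and> computable F_J \<and>
      (\<forall>(G :: 'a monoid) (gs :: 'a list) (r :: nat) (A :: nat \<Rightarrow> 'a set)
          (d :: nat \<Rightarrow> overgroup_data).
        group G \<and> set gs \<subseteq> carrier G \<and> generate G (set gs) = carrier G \<and> 1 \<le> r \<and>
        (\<forall>i\<in>{1..r}. explicitly_benign G gs (A i) (d i)) \<longrightarrow>
          explicitly_benign G gs (\<Inter>i\<in>{1..r}. A i) (F_I (map d [1..<Suc r])) \<and>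
          explicitly_benign G gs (generate G (\<Union>i\<in>{1..r}. A i)) (F_J (map d [1..<Suc r])))"
  proof (rule exI[of _ "fold_data intersection_data"], rule exI[of _ "fold_data join_data"],
      intro conjI allI impI)
    show "computable (fold_data intersection_data)"
      by (rule computable_fold_data[OF recursive_via_intersection_data])
    show "computable (fold_data join_data)"
      by (rule computable_fold_data[OF recursive_via_join_data])
  next
    fix G :: "'a monoid" and gs and r :: nat and A d
    assume *: "group G \<and> set gs \<subseteq> carrier G \<and> generate G (set gs) = carrier G \<and> 1 \<le> r \<and>
      (\<forall>i\<in>{1..r}. explicitly_benign G gs (A i) (d i))"
    then have G: "group G" "set gs \<subseteq> carrier G" "generate G (set gs) = carrier G" "1 \<le> r"
      and A: "\<And>i. i \<in> {1..r} \<Longrightarrow> explicitly_benign G gs (A i) (d i)" by blast+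
    show "explicitly_benign G gs (\<Inter>i\<in>{1..r}. A i)
        (fold_data intersection_data (map d [1..<Suc r]))"
      by (rule explicitly_benign_Inter[OF G A])
    show "explicitly_benign G gs (generate G (\<Union>i\<in>{1..r}. A i))
        (fold_data join_data (map d [1..<Suc r]))"
      by (rule explicitly_benign_Join[OF G A])
  qed
qed

end
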